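(* Let $n>0$, $x>0$, $\delta\in\mathbb R$ and $y=x^2/(n+x^2)$ (so $0<y<1$). Let the function $H_n(x;\delta)$ be defined by the contour integral $$H_n(x;\delta)=\tfrac12e^{-\frac12\delta^2}\frac{\sqrt{y}\,(1-y)^{\frac12n}}{2\pi i}\int_{-\infty}^{(1+)}e^{\frac12\delta^2 y\tau}\,\frac{\tau^{\frac12n-\frac12}}{(\tau-1)^{\frac12n}(1-y\tau)}\,d\tau,$$ where the contour starts at $-\infty$ with the phases of $\tau$ and $\tau-1$ equal to $-\pi$, encircles $\tau=1$ anti-clockwise, and terminates at $-\infty$ with the phases of $\tau$ and $\tau-1$ equal to $+\pi$; the contour cuts the positive real axis between $1$ and $1/y$. Then $$H_n(x;\delta)=P_n(x;\delta)+R_n(x;\delta),\qquad F_n(x;\delta)=2H_n(x;\delta)-R_n(x;\delta).$$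
   Context: Notation. $\operatorname{erfc}(z)=\frac{2}{\sqrt\pi}\int_z^\infty e^{-t^2}dt$. $I_y(a,b)=\frac{1}{B(a,b)}\int_0^y t^{a-1}(1-t)^{b-1}dt$ is the normalized incomplete beta function, with $B(a,b)=\Gamma(a)\Gamma(b)/\Gamma(a+b)$. For $x\ge 0$, $\delta\in\mathbb R$, $n>0$ (not necessarily an integer), with $y=x^2/(n+x^2)$, the noncentral $t$-distribution is $$F_n(x;\delta)=\tfrac12\operatorname{erfc}\left(\delta/\sqrt2\right)+P_n(x;\delta)+Q_n(x;\delta),$$ $$P_n(x;\delta)=\tfrac12 e^{-\frac12\delta^2}\sum_{j=0}^\infty \frac{(\frac12\delta^2)^j}{j!}\, I_y\left(j+\tfrac12,\tfrac12 n\right),\qquad Q_n(x;\delta)=\tfrac12 e^{-\frac12\delta^2}\sum_{j=0}^\infty \frac{\delta}{\sqrt2}\frac{(\frac12\delta^2)^j}{\Gamma(j+\frac32)}\, I_y\left(j+1,\tfrac12 n\right),$$ and $R_n(x;\delta)=\tfrac12\operatorname{erfc}(\delta/\sqrt2)+Q_n(x;\delta)-P_n(x;\delta)$.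
   Formalization: The result is proved for δ ≥ 0 only: for every δ < 0 the claimed identity fails, since H depends on δ only through δ² while P+R at −δ equals 1 minus its value at δ, which is strictly below 1/2 for δ > 0. *)

theory Defs
  imports "HOL-Analysis.Analysis"
begin

definition erfc :: "real \<Rightarrow> real" where
  "erfc z = 2 / sqrt pi * integral {z..} (\<lambda>t. exp (- (t\<^sup>2)))"

definition inc_beta :: "real \<Rightarrow> real \<Rightarrow> real \<Rightarrow> real" where
  "inc_beta y a b =
     1 / Beta a b * integral {0..y} (\<lambda>t. t powr (a - 1) * (1 - t) powr (b - 1))"

definition nct_y :: "real \<Rightarrow> real \<Rightarrow> real" where
  "nct_y n x = x\<^sup>2 / (n + x\<^sup>2)"

definition nct_P :: "real \<Rightarrow> real \<Rightarrow> real \<Rightarrow> real" where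
  "nct_P n x \<delta> = 1/2 * exp (- \<delta>\<^sup>2 / 2) *
     (\<Sum>j. (\<delta>\<^sup>2 / 2) ^ j / fact j * inc_beta (nct_y n x) (real j + 1/2) (n/2))"

definition nct_Q :: "real \<Rightarrow> real \<Rightarrow> real \<Rightarrow> real" where
  "nct_Q n x \<delta> = 1/2 * exp (- \<delta>\<^sup>2 / 2) *
     (\<Sum>j. \<delta> / sqrt 2 * ((\<delta>\<^sup>2 / 2) ^ j / Gamma (real j + 3/2))
            * inc_beta (nct_y n x) (real j + 1) (n/2))"

definition nct_F :: "real \<Rightarrow> real \<Rightarrow> real \<Rightarrow> real" where
  "nct_F n x \<delta> = 1/2 * erfc (\<delta> / sqrt 2) + nct_P n x \<delta> + nct_Q n x \<delta>"

definition nct_R :: "real \<Rightarrow> real \<Rightarrow> real \<Rightarrow> real" where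
  "nct_R n x \<delta> = 1/2 * erfc (\<delta> / sqrt 2) + nct_Q n x \<delta> - nct_P n x \<delta>"

text \<open>
  Admissible contours for the loop integral from \<open>-\<infinity>\<close> around \<open>1\<close>, parametrised by the
  whole real line. The last condition keeps the contour off the cut \<open>(-\<infinity>, 1]\<close>, so that the
  phases of \<open>\<tau>\<close> and \<open>\<tau> - 1\<close> are the principal ones all along the contour, and makes it
  meet the positive real axis only between \<open>1\<close> and \<open>1/y\<close>. Passing in this way from phase
  \<open>-\<pi>\<close> to phase \<open>\<pi>\<close> is what encircling \<open>1\<close> once anti-clockwise means.
\<close>

definition loop_contour :: "real \<Rightarrow> (real \<Rightarrow> complex) \<Rightarrow> bool" where
  "loop_contour y \<gamma> \<longleftrightarrow>
     (\<forall>a b. \<gamma> piecewise_C1_differentiable_on {a..b}) \<and>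
     filterlim \<gamma> at_infinity at_bot \<and>
     ((\<lambda>t. Arg (\<gamma> t)) \<longlongrightarrow> - pi) at_bot \<and>
     ((\<lambda>t. Arg (\<gamma> t - 1)) \<longlongrightarrow> - pi) at_bot \<and>
     filterlim \<gamma> at_infinity at_top \<and>
     ((\<lambda>t. Arg (\<gamma> t)) \<longlongrightarrow> pi) at_top \<and>
     ((\<lambda>t. Arg (\<gamma> t - 1)) \<longlongrightarrow> pi) at_top \<and>
     (\<forall>t. \<gamma> t \<in> \<real> \<longrightarrow> 1 < Re (\<gamma> t) \<and> Re (\<gamma> t) < 1 / y)"

text \<open>
  The Henstock--Kurzweil integral over the whole line is the limit of the integrals over
  compact intervals, both ends tending to infinity independently; hence this is the improper
  contour integral and absolute convergence is not required.
\<close>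

definition loop_integral :: "(real \<Rightarrow> complex) \<Rightarrow> (complex \<Rightarrow> complex) \<Rightarrow> complex" where
  "loop_integral \<gamma> f = integral UNIV (\<lambda>t. f (\<gamma> t) * vector_derivative \<gamma> (at t))"

definition nct_H_integrand :: "real \<Rightarrow> real \<Rightarrow> real \<Rightarrow> complex \<Rightarrow> complex" where
  "nct_H_integrand n x \<delta> \<tau> =
     exp (of_real (\<delta>\<^sup>2 / 2 * nct_y n x) * \<tau>) *
     (\<tau> powr of_real (n/2 - 1/2)
        / ((\<tau> - 1) powr of_real (n/2) * (1 - of_real (nct_y n x) * \<tau>)))"

definition nct_H :: "real \<Rightarrow> real \<Rightarrow> real \<Rightarrow> (real \<Rightarrow> complex) \<Rightarrow> complex" where
  "nct_H n x \<delta> \<gamma> =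
     of_real (1/2 * exp (- \<delta>\<^sup>2 / 2)) *
     (of_real (sqrt (nct_y n x) * (1 - nct_y n x) powr (n/2)) / (2 * of_real pi * \<i>)) *
     loop_integral \<gamma> (nct_H_integrand n x \<delta>)"

lemma tendsto_Arg_parabola:
  fixes c :: real
  shows "((\<lambda>t. Arg (Complex (c - t\<^sup>2) t)) \<longlongrightarrow> pi) at_top"
    and "((\<lambda>t. Arg (Complex (c - t\<^sup>2) t)) \<longlongrightarrow> - pi) at_bot"
proof -
  have *: "((\<lambda>t. arctan (t / (c - t\<^sup>2))) \<longlongrightarrow> 0) F" if "F = at_top \<or> F = at_bot" for F
  proof -
    have "((\<lambda>t. t / (c - t\<^sup>2)) \<longlongrightarrow> 0) at_top"
    proof -
      have "((\<lambda>t. inverse t / (c * (inverse t)\<^sup>2 - 1)) \<longlongrightarrow> 0 / (c * 0\<^sup>2 - 1)) (at_top :: real filter)"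
        by (intro tendsto_intros tendsto_inverse_0_at_top filterlim_ident) auto
      moreover have "\<forall>\<^sub>F t in at_top. inverse t / (c * (inverse t)\<^sup>2 - 1) = t / (c - t\<^sup>2)"
        using eventually_gt_at_top[of 0]
        by eventually_elim (simp add: divide_simps power2_eq_square)
      ultimately show ?thesis
        using tendsto_cong by fastforce
    qed
    hence 1: "((\<lambda>t. arctan (t / (c - t\<^sup>2))) \<longlongrightarrow> 0) at_top"
      using tendsto_arctan by fastforce
    have "((\<lambda>t. - arctan (t / (c - t\<^sup>2))) \<longlongrightarrow> - 0) at_top"
      by (intro tendsto_intros 1)
    hence "((\<lambda>t. arctan (t / (c - t\<^sup>2))) \<longlongrightarrow> 0) at_bot"
      by (simp add: filterlim_at_bot_mirror arctan_minus minus_divide_left [symmetric])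
    with 1 that show ?thesis by auto
  qed
  have neg: "c - t\<^sup>2 < 0" if "\<bar>t\<bar> > max 1 \<bar>c\<bar>" for t
  proof -
    have "\<bar>t\<bar> * 1 \<le> \<bar>t\<bar> * \<bar>t\<bar>" using that by (intro mult_left_mono) auto
    thus ?thesis using that by (auto simp: power2_eq_square)
  qed
  have "((\<lambda>t. arctan (t / (c - t\<^sup>2)) + pi) \<longlongrightarrow> 0 + pi) at_top"
    by (intro tendsto_intros *) auto
  moreover have "\<forall>\<^sub>F t in at_top. arctan (t / (c - t\<^sup>2)) + pi = Arg (Complex (c - t\<^sup>2) t)"
    using eventually_gt_at_top[of "max 1 \<bar>c\<bar>"]
  proof eventually_elim
    case (elim t)
    with neg[of t] show ?case
      by (subst Arg_eq_Im_Ln) (auto simp: Im_Ln_eq complex_eq_iff)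
  qed
  ultimately show "((\<lambda>t. Arg (Complex (c - t\<^sup>2) t)) \<longlongrightarrow> pi) at_top"
    using tendsto_cong by fastforce
  have "((\<lambda>t. arctan (t / (c - t\<^sup>2)) - pi) \<longlongrightarrow> 0 - pi) at_bot"
    by (intro tendsto_intros *) auto
  moreover have "\<forall>\<^sub>F t in at_bot. arctan (t / (c - t\<^sup>2)) - pi = Arg (Complex (c - t\<^sup>2) t)"
    using eventually_gt_at_bot[of "- max 1 \<bar>c\<bar>"]
  proof eventually_elim
    case (elim t)
    hence "t < 0" "c - t\<^sup>2 < 0" using neg[of t] by (auto simp: max_def split: if_splits)
    thus ?case
      by (subst Arg_eq_Im_Ln) (auto simp: Im_Ln_eq complex_eq_iff)
  qed
  ultimately show "((\<lambda>t. Arg (Complex (c - t\<^sup>2) t)) \<longlongrightarrow> - pi) at_bot"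
    using tendsto_cong by fastforce
qed

lemma loop_contour_parabola:
  assumes "1 < c" "c < 1 / y"
  shows "loop_contour y (\<lambda>t. Complex (c - t\<^sup>2) t)"
proof -
  have deriv: "((\<lambda>t. Complex (c - t\<^sup>2) t) has_vector_derivative Complex (- 2 * t) 1) (at t)" for t
    unfolding Complex_eq
    by (auto intro!: derivative_eq_intros simp: has_vector_derivative_def fun_eq_iff complex_eq_iff)
  have "(\<lambda>t. Complex (c - t\<^sup>2) t) C1_differentiable_on {a..b}" for a b
    unfolding C1_differentiable_on_def
    by (rule exI[of _ "\<lambda>t. Complex (- 2 * t) 1"])
       (use deriv in \<open>auto simp: Complex_eq intro!: continuous_intros\<close>)
  moreover have "filterlim (\<lambda>t. Complex (c - t\<^sup>2) t) at_infinity F"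
    if "filterlim (\<lambda>t::real. \<bar>t\<bar>) at_top F" for F
    unfolding filterlim_at_infinity_conv_norm_at_top
    by (rule filterlim_at_top_mono[OF that])
       (auto intro!: always_eventually order.trans[OF _ abs_Im_le_cmod])
  moreover have "Complex (c - t\<^sup>2) t - 1 = Complex ((c - 1) - t\<^sup>2) t" for t
    by (simp add: complex_eq_iff)
  moreover have "filterlim (\<lambda>t::real. \<bar>t\<bar>) at_top at_bot"
    using filterlim_abs_real by (simp add: filterlim_at_bot_mirror)
  ultimately show ?thesis
    using assms tendsto_Arg_parabola[of c] tendsto_Arg_parabola[of "c - 1"] filterlim_abs_real
    by (auto simp: loop_contour_def complex_is_Real_iff C1_differentiable_imp_piecewise)
qed

end

theory Submission
  imports Defs "HOL-Complex_Analysis.Cauchy_Integral_Theorem" "HOL-Probability.Sinc_Integral"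
begin

text \<open>
  Put \<open>d = \<delta> / sqrt 2\<close>, \<open>b = n / 2\<close> and substitute \<open>z = sqrt y * csqrt \<tau>\<close>. The integrand becomes
  \<open>exp (d\<^sup>2 z\<^sup>2) (1 - y / z\<^sup>2) powr (-b) / (1 - z\<^sup>2)\<close>, the two rays avoided by the contour become the
  real points of the right half plane outside \<open>(sqrt y, 1)\<close>, and the slit half plane is starlike; so
  there is a primitive, and every admissible contour can be replaced by a vertical line
  \<open>Re z = c\<close> with \<open>sqrt y < c < 1\<close>. On this line the binomial series in \<open>y / z\<^sup>2\<close> may be integrated
  termwise. The \<open>k\<close>-th term is a multiple of \<open>K\<^sub>k = \<integral> exp (d\<^sup>2 z\<^sup>2) / (1 - z\<^sup>2) / z ^ (2 k)\<close>, where
  \<open>K\<^sub>0\<close> is moved to the imaginary axis and equals \<open>\<pi> exp (d\<^sup>2) erfc d\<close>, while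
  \<open>K\<^bsub>k+1\<^esub> - K\<^sub>k\<close> is a Hankel integral for \<open>1 / \<Gamma>(k + 3/2)\<close>. Summation by parts turns the negative
  binomial weights into their tails, which are the incomplete beta functions in \<open>Q\<close>.
\<close>

section \<open>Negative binomial weights\<close>

lemma gbinomial_minus_times_power_minus:
  fixes a z :: "'a :: field_char_0"
  shows "((- a) gchoose k) * (- z) ^ k = pochhammer a k / fact k * z ^ k"
proof -
  have "(-1) ^ k * (- z) ^ k = z ^ k"
    unfolding power_mult_distrib[symmetric] by simp
  then show ?thesis
    by (simp add: gbinomial_pochhammer field_simps)
qed

lemma negative_binomial_sums_complex:
  fixes z :: complex and b :: real
  assumes "norm z < 1"
  shows "(\<lambda>k. of_real (pochhammer b k / fact k) * z ^ k) sums (1 - z) powr (- of_real b)"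
  using gen_binomial_complex[of "-z" "- of_real b"] assms
  by (simp add: gbinomial_minus_times_power_minus pochhammer_of_real)

lemma negative_binomial_sums:
  fixes t b :: real
  assumes "\<bar>t\<bar> < 1"
  shows "(\<lambda>k. pochhammer b k / fact k * t ^ k) sums (1 - t) powr (- b)"
  using gen_binomial_real[of "-t" "- b"] assms
  by (simp add: gbinomial_minus_times_power_minus)

text \<open>The derivative telescopes. Write B_k for \<open>pochhammer b k / fact k\<close>, so that
  (k + b) B_k = (k + 1) B_(k+1). After (1 - t)^(b - 1) is pulled out, the k-th summand contributes k
  B_k t^(k-1) - (k + 1) B_(k+1) t^k, and only the last negative term survives.\<close>

lemma negative_binomial_partial_deriv:
  fixes t b :: real
  assumes "t < 1"
  shows "((\<lambda>t. \<Sum>k\<le>j. pochhammer b k / fact k * t ^ k * (1 - t) powr b) has_real_derivative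
    - (pochhammer b (Suc j) / fact j * t ^ j * (1 - t) powr (b - 1))) (at t)"
proof (induction j)
  case 0
  show ?case using assms
    by (auto intro!: derivative_eq_intros)
next
  case (Suc j)
  have pw: "(1 - t) powr b = (1 - t) * (1 - t) powr (b - 1)"
    using assms by (simp add: powr_diff)
  have d: "((\<lambda>t. pochhammer b (Suc j) / fact (Suc j) * t ^ Suc j * (1 - t) powr b) has_real_derivative
      pochhammer b (Suc j) / fact (Suc j) * (real (Suc j) * t ^ j * (1 - t) powr b
        - t ^ Suc j * b * (1 - t) powr (b - 1))) (at t)"
    using assms by (auto intro!: derivative_eq_intros simp del: fact_Suc power_Suc)
      (simp add: algebra_simps)
  have "- (pochhammer b (Suc j) / fact j * t ^ j * (1 - t) powr (b - 1)) +
      pochhammer b (Suc j) / fact (Suc j) * (real (Suc j) * t ^ j * (1 - t) powr b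
        - t ^ Suc j * b * (1 - t) powr (b - 1)) =
      - (pochhammer b (Suc (Suc j)) / fact (Suc j) * t ^ Suc j * (1 - t) powr (b - 1))"
    unfolding pw by (simp add: pochhammer_Suc[of b "Suc j"] divide_simps)
      (simp add: algebra_simps)
  then show ?case
    using DERIV_add[OF Suc d] by simp
qed

text \<open>Up to sign, the normalized beta integrand is the derivative of the partial sum in
  \<open>negative_binomial_partial_deriv\<close>, and that partial sum equals 1 at t = 0. So the
  incomplete beta function is a tail of the negative binomial weights.\<close>

lemma inc_beta_eq_one_minus_negative_binomial:
  fixes y b :: real
  assumes "0 < y" "y < 1" "0 < b"
  shows "inc_beta y (real j + 1) b =
    1 - (\<Sum>k\<le>j. pochhammer b k / fact k * y ^ k * (1 - y) powr b)"
proof -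
  let ?D = "\<lambda>t. \<Sum>k\<le>j. pochhammer b k / fact k * t ^ k * (1 - t) powr b"
  \<comment> \<open>This constant turns out to be the reciprocal of
    \<open>Beta (real j + 1) b\<close>.\<close>
  define c where "c = pochhammer b (Suc j) / fact j"
  have c: "c > 0"
    using assms by (simp add: pochhammer_pos c_def)
  have I: "((\<lambda>t. - (c * t ^ j * (1 - t) powr (b - 1))) has_integral ?D y - ?D 0) {0..y}"
  proof (rule fundamental_theorem_of_calculus)
    fix t assume "t \<in> {0..y}"
    then have "(?D has_real_derivative - (c * t ^ j * (1 - t) powr (b - 1))) (at t)"
      using assms unfolding c_def by (intro negative_binomial_partial_deriv) auto
    then show "(?D has_vector_derivative - (c * t ^ j * (1 - t) powr (b - 1))) (at t within {0..y})"
      unfolding has_real_derivative_iff_has_vector_derivative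
      by (rule has_vector_derivative_at_within)
  qed (use assms in simp)
  have D0: "?D 0 = 1"
  proof -
    have "?D 0 = (\<Sum>k\<in>{0}. pochhammer b k / fact k * 0 ^ k * (1 - 0) powr b)"
      by (rule sum.mono_neutral_right) auto
    then show ?thesis by simp
  qed
  have "((\<lambda>t. - inverse c * (- (c * t ^ j * (1 - t) powr (b - 1)))) has_integral
      - inverse c * (?D y - 1)) {0..y}"
    using has_integral_mult_right[OF I, of "- inverse c"] unfolding D0 .
  moreover have "- inverse c * (- (c * t ^ j * (1 - t) powr (b - 1))) =
      t ^ j * (1 - t) powr (b - 1)" for t
    using c by simp
  ultimately have "((\<lambda>t. t ^ j * (1 - t) powr (b - 1)) has_integral - inverse c * (?D y - 1)) {0..y}"
    by (simp only:)
  \<comment> \<open>For j = 0 the integrands differ at t = 0, where \<open>0 powr 0\<close> is 0 but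
    \<open>0 ^ 0\<close> is 1; hence the null set \<open>{0}\<close>.\<close>
  then have J: "((\<lambda>t. t powr (real j + 1 - 1) * (1 - t) powr (b - 1)) has_integral
      - inverse c * (?D y - 1)) {0..y}"
    by (rule has_integral_spike[of "{0}", rotated 2]) (auto simp: powr_realpow)
  have "Beta (real j + 1) b = inverse c"
  proof -
    have "pochhammer b (Suc j) = Gamma (b + real (Suc j)) / Gamma b"
      using assms by (intro pochhammer_Gamma) (auto elim!: nonpos_Ints_cases)
    moreover have "Gamma (b + real (Suc j)) > 0" "Gamma b > 0"
      using assms by (auto intro!: Gamma_real_pos)
    ultimately show ?thesis
      using Gamma_fact[of j, where 'a=real] by (simp add: Beta_def c_def add_ac)
  qed
  then have "inc_beta y (real j + 1) b = c * (- inverse c * (?D y - 1))"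
    unfolding inc_beta_def integral_unique[OF J] by simp
  also have "\<dots> = 1 - ?D y"
    using c by (simp add: field_simps)
  finally show ?thesis .
qed

text \<open>Summation by parts: h j is collected from all k > j, which gives it the tail of
  \<open>c\<close> as weight. In the finite identity the boundary term is (1 - sum of c) times a
  partial sum of \<open>h\<close>; it vanishes in the limit because the first factor tends to 0 and
  the second converges.\<close>

lemma sums_weighted_partial_sums_iff:
  fixes c h :: "nat \<Rightarrow> real"
  assumes c: "c sums 1" and h: "summable h"
  shows "(\<lambda>k. c k * (K + (\<Sum>j<k. h j))) sums S \<longleftrightarrow>
    (\<lambda>j. h j * (1 - (\<Sum>k\<le>j. c k))) sums (S - K)"
proof -
  have eq: "(\<Sum>k<N. c k * (K + (\<Sum>j<k. h j))) - K * (\<Sum>k<N. c k)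
      = (\<Sum>j<N. h j * (1 - (\<Sum>k\<le>j. c k))) - (1 - (\<Sum>k<N. c k)) * (\<Sum>j<N. h j)" for N
    by (induction N) (auto simp: algebra_simps lessThan_Suc_atMost[symmetric])
  have c': "(\<lambda>N. \<Sum>k<N. c k) \<longlonglongrightarrow> 1"
    using c by (simp add: sums_def)
  have "(\<lambda>N. (1 - (\<Sum>k<N. c k)) * (\<Sum>j<N. h j)) \<longlonglongrightarrow> (1 - 1) * suminf h"
    using c' summable_LIMSEQ[OF h] by (intro tendsto_intros)
  moreover have "(\<lambda>N. K * (\<Sum>k<N. c k)) \<longlonglongrightarrow> K * 1"
    using c' by (intro tendsto_intros)
  ultimately have e: "(\<lambda>N. K * (\<Sum>k<N. c k) - (1 - (\<Sum>k<N. c k)) * (\<Sum>j<N. h j)) \<longlonglongrightarrow> K"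
    using tendsto_diff by fastforce
  have eq': "(\<Sum>k<N. c k * (K + (\<Sum>j<k. h j))) = (\<Sum>j<N. h j * (1 - (\<Sum>k\<le>j. c k))) +
      (K * (\<Sum>k<N. c k) - (1 - (\<Sum>k<N. c k)) * (\<Sum>j<N. h j))" for N
    using eq[of N] by simp
  show ?thesis
    unfolding sums_def eq' using tendsto_add[OF _ e, of _ "S - K"] tendsto_diff[OF _ e, of _ S] by fastforce
qed

section \<open>Shifting improper contour integrals\<close>

text \<open>On the line, \<open>ball 0 B\<close> lies in \<open>{a..b}\<close> exactly when a \<le>
  -B and B \<le> b. The gauge definition therefore says that both ends tend to infinity
  independently, which is a limit along the product filter.\<close>

lemma has_integral_UNIV_iff_tendsto:
  fixes f :: "real \<Rightarrow> 'a :: banach"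
  shows "(f has_integral I) UNIV \<longleftrightarrow> (\<forall>a b. f integrable_on {a..b}) \<and>
    ((\<lambda>(a, b). integral {a..b} f) \<longlongrightarrow> I) (at_bot \<times>\<^sub>F at_top)"
    (is "?L \<longleftrightarrow> ?R1 \<and> ?R2")
proof -
  have "(\<forall>e>0. \<exists>B>0. \<forall>a b. ball 0 B \<subseteq> cbox a b \<longrightarrow> norm (integral (cbox a b) f - I) < e) \<longleftrightarrow> ?R2"
    (is "?L2 \<longleftrightarrow> ?R2")
  proof
    assume L: ?L2
    show ?R2
    proof (rule tendstoI)
      fix e :: real assume "e > 0"
      with L obtain B where B: "B > 0"
        "\<And>a b. ball 0 B \<subseteq> cbox a b \<Longrightarrow> norm (integral (cbox a b) f - I) < e"
        by blast
      have "\<forall>\<^sub>F p in at_bot \<times>\<^sub>F at_top. fst p \<le> - B \<and> snd p \<ge> B"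
        using eventually_prodI[OF eventually_le_at_bot[of "-B"] eventually_ge_at_top[of B]] .
      then show "\<forall>\<^sub>F p in at_bot \<times>\<^sub>F at_top. dist (case p of (a, b) \<Rightarrow> integral {a..b} f) I < e"
      proof eventually_elim
        case (elim p)
        then have "ball 0 B \<subseteq> cbox (fst p) (snd p)"
          by (auto simp: dist_real_def)
        from B(2)[OF this] show ?case
          by (simp add: dist_norm case_prod_unfold)
      qed
    qed
  next
    assume R: ?R2
    show ?L2
    proof (intro allI impI)
      fix e :: real assume "e > 0"
      with R have "\<forall>\<^sub>F p in at_bot \<times>\<^sub>F at_top. dist (case p of (a, b) \<Rightarrow> integral {a..b} f) I < e"
        by (rule tendstoD)
      then obtain P Q where PQ: "eventually P at_bot" "eventually Q at_top"
        "\<And>a b. P a \<Longrightarrow> Q b \<Longrightarrow> dist (integral {a..b} f) I < e"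
        unfolding eventually_prod_filter by auto
      obtain M N where MN: "\<And>a. a \<le> M \<Longrightarrow> P a" "\<And>b. b \<ge> N \<Longrightarrow> Q b"
        using PQ(1,2) unfolding eventually_at_bot_linorder eventually_at_top_linorder by blast
      define B where "B = Max {1, - M, N}"
      have B: "B > 0" "- M \<le> B" "N \<le> B"
        unfolding B_def by auto
      have "norm (integral (cbox a b) f - I) < e" if "ball 0 B \<subseteq> cbox a b" for a b
      proof -
        have "a \<le> - B" "B \<le> b"
          using that B(1) by (auto simp: ball_eq_greaterThanLessThan greaterThanLessThan_subseteq_atLeastAtMost_iff)
        then show ?thesis
          using PQ(3)[of a b] MN B by (simp add: dist_norm)
      qed
      with B(1) show "\<exists>B>0. \<forall>a b. ball 0 B \<subseteq> cbox a b \<longrightarrow> norm (integral (cbox a b) f - I) < e"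
        by blast
    qed
  qed
  then show ?thesis
    by (subst has_integral_alt') simp
qed

text \<open>Both improper integrals are limits of increments of antiderivatives. The increment of
  \<open>G\<close> between two parameters differs from that of \<open>F\<close> between their images
  under \<open>v\<close> by two end terms, both tending to 0. This compares two contours through
  their ends alone.\<close>

lemma has_integral_UNIV_transfer:
  fixes f g F G :: "real \<Rightarrow> 'a :: banach"
  assumes f: "(f has_integral I) UNIV"
    and F: "\<And>a b. a \<le> b \<Longrightarrow> (f has_integral F b - F a) {a..b}"
    and G: "\<And>a b. a \<le> b \<Longrightarrow> (g has_integral G b - G a) {a..b}"
    and v: "filterlim v at_bot at_bot" "filterlim v at_top at_top"
    and lim: "((\<lambda>t. G t - F (v t)) \<longlongrightarrow> 0) at_bot" "((\<lambda>t. G t - F (v t)) \<longlongrightarrow> 0) at_top"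
  shows "(g has_integral I) UNIV"
proof -
  have ev: "\<forall>\<^sub>F p in at_bot \<times>\<^sub>F at_top. fst p \<le> (0 :: real) \<and> snd p \<ge> (0 :: real)"
    using eventually_prodI[OF eventually_le_at_bot[of 0] eventually_ge_at_top[of 0]] .
  have "((\<lambda>(a, b). integral {a..b} f) \<longlongrightarrow> I) (at_bot \<times>\<^sub>F at_top)"
    using f unfolding has_integral_UNIV_iff_tendsto by blast
  moreover have "\<forall>\<^sub>F p in at_bot \<times>\<^sub>F at_top. (case p of (a, b) \<Rightarrow> integral {a..b} f) = F (snd p) - F (fst p)"
    using ev by eventually_elim (auto simp: case_prod_unfold intro!: integral_unique F)
  ultimately have "((\<lambda>p. F (snd p) - F (fst p)) \<longlongrightarrow> I) (at_bot \<times>\<^sub>F at_top)"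
    by (rule Lim_transform_eventually)
  moreover have "filterlim (\<lambda>p. (v (fst p), v (snd p))) (at_bot \<times>\<^sub>F at_top) (at_bot \<times>\<^sub>F at_top)"
    by (intro filterlim_Pair filterlim_compose[OF v(1)] filterlim_compose[OF v(2)]
        filterlim_fst filterlim_snd)
  ultimately have "((\<lambda>p. F (v (snd p)) - F (v (fst p))) \<longlongrightarrow> I) (at_bot \<times>\<^sub>F at_top)"
    using filterlim_compose[of "\<lambda>p. F (snd p) - F (fst p)"] by fastforce
  moreover have "((\<lambda>p. G (fst p) - F (v (fst p))) \<longlongrightarrow> 0) (at_bot \<times>\<^sub>F at_top)"
    using filterlim_compose[OF lim(1) filterlim_fst] .
  moreover have "((\<lambda>p. G (snd p) - F (v (snd p))) \<longlongrightarrow> 0) (at_bot \<times>\<^sub>F at_top)"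
    using filterlim_compose[OF lim(2) filterlim_snd] .
  ultimately have "((\<lambda>p. (F (v (snd p)) - F (v (fst p))) - (G (fst p) - F (v (fst p)))
      + (G (snd p) - F (v (snd p)))) \<longlongrightarrow> I - 0 + 0) (at_bot \<times>\<^sub>F at_top)"
    by (intro tendsto_intros)
  then have "((\<lambda>p. G (snd p) - G (fst p)) \<longlongrightarrow> I) (at_bot \<times>\<^sub>F at_top)"
    by (simp add: algebra_simps)
  moreover have "\<forall>\<^sub>F p in at_bot \<times>\<^sub>F at_top. G (snd p) - G (fst p) = (case p of (a, b) \<Rightarrow> integral {a..b} g)"
    using ev by eventually_elim (auto simp: case_prod_unfold intro!: integral_unique[symmetric] G)
  ultimately have "((\<lambda>(a, b). integral {a..b} g) \<longlongrightarrow> I) (at_bot \<times>\<^sub>F at_top)"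
    by (rule Lim_transform_eventually)
  moreover have "g integrable_on {a..b}" for a b
    using G[of a b] by (cases "a \<le> b") (auto simp: integrable_on_def)
  ultimately show ?thesis
    unfolding has_integral_UNIV_iff_tendsto by blast
qed

lemma has_integral_vertical_segment:
  assumes "\<And>u. (G has_field_derivative \<phi> (Complex c u)) (at (Complex c u))" "a \<le> b"
  shows "((\<lambda>u. \<i> * \<phi> (Complex c u)) has_integral G (Complex c b) - G (Complex c a)) {a..b}"
proof (rule fundamental_theorem_of_calculus)
  fix u
  have "((\<lambda>u. Complex c u) has_vector_derivative \<i>) (at u within {a..b})"
    unfolding Complex_eq by (auto intro!: derivative_eq_intros)
  from field_vector_diff_chain_within[OF this has_field_derivative_at_within[OF assms(1)]]
  show "((\<lambda>u. G (Complex c u)) has_vector_derivative \<i> * \<phi> (Complex c u)) (at u within {a..b})"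
    by (simp add: o_def)
qed fact

lemma horizontal_increment_bound:
  assumes "\<And>s. s \<in> closed_segment x x' \<Longrightarrow> (G has_field_derivative \<phi> (Complex s u)) (at (Complex s u))"
    and "\<And>s. s \<in> closed_segment x x' \<Longrightarrow> norm (\<phi> (Complex s u)) \<le> B"
  shows "norm (G (Complex x u) - G (Complex x' u)) \<le> B * \<bar>x - x'\<bar>"
proof -
  \<comment> \<open>The horizontal segment itself, as a convex set on which the mean value
    inequality applies.\<close>
  define S where "S = {z. Re z \<ge> min x x'} \<inter> {z. Re z \<le> max x x'} \<inter> {z. Im z = u}"
  have "convex S"
    unfolding S_def
    by (intro convex_Int convex_halfspace_Re_ge convex_halfspace_Re_le)
      (auto simp: convex_alt algebra_simps)
  moreover have S: "Re z \<in> closed_segment x x'" "Complex (Re z) u = z" if "z \<in> S" for z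
    using that unfolding S_def by (auto simp: closed_segment_eq_real_ivl complex_eq_iff min_def max_def split: if_splits)
  moreover have "(G has_field_derivative \<phi> z) (at z within S)" "norm (\<phi> z) \<le> B" if "z \<in> S" for z
    using assms[OF S(1)[OF that]] unfolding S(2)[OF that] by (auto intro: has_field_derivative_at_within)
  moreover have "Complex x u \<in> S" "Complex x' u \<in> S"
    by (auto simp: S_def)
  ultimately have "norm (G (Complex x u) - G (Complex x' u)) \<le> B * norm (Complex x u - Complex x' u)"
    by (intro field_differentiable_bound[where S = S and f' = \<phi>]) auto
  also have "norm (Complex x u - Complex x' u) = \<bar>x - x'\<bar>"
    by (simp add: cmod_def)
  finally show ?thesis .
qed

text \<open>A primitive \<open>G\<close> of the integrand exists on the convex set \<open>S\<close>.
  At height u its values on the two lines differ by at most \<open>B u\<close> times their distance,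
  which tends to 0 at both ends. The factor \<i> is the velocity of the line and is divided out at
  the end.\<close>

lemma vertical_line_shift:
  assumes hol: "\<phi> holomorphic_on S" "open S" "convex S"
    and S: "\<And>u. Complex c u \<in> S" "\<And>u. Complex c' u \<in> S"
    and int: "((\<lambda>u. \<phi> (Complex c u)) has_integral I) UNIV"
    and bound: "\<And>x u. x \<in> closed_segment c c' \<Longrightarrow> norm (\<phi> (Complex x u)) \<le> B u"
    and B: "(B \<longlongrightarrow> 0) at_bot" "(B \<longlongrightarrow> 0) at_top"
  shows "((\<lambda>u. \<phi> (Complex c' u)) has_integral I) UNIV"
proof -
  obtain G where G': "\<And>z. z \<in> S \<Longrightarrow> (G has_field_derivative \<phi> z) (at z within S)"
    using holomorphic_convex_primitive'[OF hol(3) hol(2) hol(1)] by blast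
  have G: "(G has_field_derivative \<phi> z) (at z)" if "z \<in> S" for z
    using G'[OF that] at_within_open[OF that hol(2)] by simp
  have seg: "Complex x u \<in> S" if x: "x \<in> closed_segment c c'" for x u
  proof -
    obtain t where t: "0 \<le> t" "t \<le> 1" "x = (1 - t) * c + t * c'"
      using x unfolding in_segment(1) by auto
    have "(1 - t) *\<^sub>R Complex c u + t *\<^sub>R Complex c' u \<in> S"
      using convexD_alt[OF hol(3) S(1) S(2)] t by blast
    also have "(1 - t) *\<^sub>R Complex c u + t *\<^sub>R Complex c' u = Complex x u"
      using t by (simp add: complex_eq_iff algebra_simps)
    finally show ?thesis .
  qed
  have inc: "norm (G (Complex c' u) - G (Complex c u)) \<le> B u * \<bar>c' - c\<bar>" for u
    by (intro horizontal_increment_bound[where \<phi> = \<phi>] G seg bound) (auto simp: closed_segment_commute)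
  have lim: "((\<lambda>u. G (Complex c' u) - G (Complex c u)) \<longlongrightarrow> 0) F" if "(B \<longlongrightarrow> 0) F" for F
  proof (rule Lim_null_comparison)
    show "\<forall>\<^sub>F u in F. norm (G (Complex c' u) - G (Complex c u)) \<le> B u * \<bar>c' - c\<bar>"
      using inc by simp
    show "((\<lambda>u. B u * \<bar>c' - c\<bar>) \<longlongrightarrow> 0) F"
      using tendsto_mult_left_zero[OF that] .
  qed
  have "((\<lambda>u. \<i> * \<phi> (Complex c' u)) has_integral \<i> * I) UNIV"
    by (rule has_integral_UNIV_transfer[where v = "\<lambda>u. u" and F = "\<lambda>u. G (Complex c u)" and
          G = "\<lambda>u. G (Complex c' u)" and f = "\<lambda>u. \<i> * \<phi> (Complex c u)"])
      (auto intro!: has_integral_mult_right int has_integral_vertical_segment G S lim B filterlim_ident)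
  from has_integral_mult_right[OF this, of "- \<i>"] show ?thesis
    by simp
qed

section \<open>The integrand after the substitution\<close>

text \<open>For z = sqrt y * csqrt tau one has dz = sqrt y dtau / (2 csqrt tau), so the factor 1 /
  csqrt tau left over from the two powers is absorbed. Hence \<open>line_kernel\<close> dz is sqrt y
  / 2 times the loop integrand dtau, with a = \<delta>^2 / 2 and b = n / 2.\<close>

definition line_kernel :: "real \<Rightarrow> real \<Rightarrow> real \<Rightarrow> complex \<Rightarrow> complex" where
  "line_kernel a b y z =
     exp (of_real a * z\<^sup>2) * (1 - of_real y / z\<^sup>2) powr (- of_real b) / (1 - z\<^sup>2)"

text \<open>The image of the complement of \<open>(-\<infinity>, 1] \<union> [1 / y, \<infinity>)\<close> under \<open>\<tau> \<mapsto> sqrt y * csqrt \<tau>\<close>.\<close>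

definition slit_half_plane :: "real \<Rightarrow> complex set" where
  "slit_half_plane y = {z. Re z > 0 \<and> (Im z \<noteq> 0 \<or> sqrt y < Re z \<and> Re z < 1)}"

lemma open_slit_half_plane: "open (slit_half_plane y)"
proof -
  have "slit_half_plane y = {z. Re z > 0} \<inter>
      (({z. Im z > 0} \<union> {z. Im z < 0}) \<union> ({z. Re z > sqrt y} \<inter> {z. Re z < 1}))"
    by (auto simp: slit_half_plane_def)
  then show ?thesis
    by (simp add: open_Int open_Un open_halfspace_Re_gt open_halfspace_Re_lt
        open_halfspace_Im_gt open_halfspace_Im_lt)
qed

text \<open>Any real point strictly between \<open>sqrt y\<close> and 1 serves as centre: a segment
  from it to a nonreal point leaves the real axis at once and does not return, and a segment to
  another point of the gap stays in the gap.\<close>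

lemma starlike_slit_half_plane:
  assumes "0 \<le> y" "y < 1"
  shows "starlike (slit_half_plane y)"
proof -
  have "0 \<le> sqrt y" "sqrt y < 1"
    using assms by simp_all
  then obtain c where c: "sqrt y < c" "c < 1" "0 < c"
    by (meson dense le_less_trans)
  have "closed_segment (of_real c) z \<subseteq> slit_half_plane y" if z: "z \<in> slit_half_plane y" for z
  proof
    fix w assume "w \<in> closed_segment (of_real c) z"
    then obtain t where t: "0 \<le> t" "t \<le> 1" and "w = (1 - t) *\<^sub>R of_real c + t *\<^sub>R z"
      unfolding in_segment(1) by blast
    then have w: "Re w = (1 - t) * c + t * Re z" "Im w = t * Im z"
      by (simp_all add: scaleR_conv_of_real)
    show "w \<in> slit_half_plane y"
    proof (cases "t = 0")
      case True
      then show ?thesis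
        using c w by (simp add: slit_half_plane_def)
    next
      case False
      have *: "l < Re w" if "l < c" "l < Re z" for l
      proof -
        have "(1 - t) * l \<le> (1 - t) * c" "t * l < t * Re z"
          using t False that by (auto intro: mult_left_mono)
        then show ?thesis
          unfolding w by (simp add: algebra_simps)
      qed
      have **: "Re w < r" if "c < r" "Re z < r" for r
      proof -
        have "(1 - t) * c \<le> (1 - t) * r" "t * Re z < t * r"
          using t False that by (auto intro: mult_left_mono)
        then show ?thesis
          unfolding w by (simp add: algebra_simps)
      qed
      show ?thesis
        using z c False *[of 0] *[of "sqrt y"] **[of 1] unfolding slit_half_plane_def by (auto simp: w(2))
    qed
  qed
  moreover have "of_real c \<in> slit_half_plane y"
    using c by (simp add: slit_half_plane_def)
  ultimately show ?thesis
    unfolding starlike_def by blast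
qed

lemma in_Reals_if_power2_eq_of_real:
  fixes z :: complex
  assumes "z\<^sup>2 = of_real r" "0 < r"
  shows "z \<in> \<real>"
proof -
  have "z\<^sup>2 = (of_real (sqrt r))\<^sup>2"
    using assms by (simp flip: of_real_power)
  then have "z = of_real (sqrt r) \<or> z = - of_real (sqrt r)"
    by (rule power2_eq_iff[THEN iffD1])
  then show ?thesis
    by auto
qed

text \<open>For the branch cut: 1 - y / z^2 = s \<le> 0 would give z^2 = y / (1 - s) in (0, y], so z
  would be real with Re z \<le> sqrt y, and such points are removed. The principal power in
  \<open>line_kernel\<close> is therefore holomorphic here.\<close>

lemma slit_half_plane_facts:
  assumes "0 < y" "z \<in> slit_half_plane y"
  shows "z \<noteq> 0" "1 - z\<^sup>2 \<noteq> 0" "1 - of_real y / z\<^sup>2 \<notin> \<real>\<^sub>\<le>\<^sub>0"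
proof -
  show z: "z \<noteq> 0" and "1 - z\<^sup>2 \<noteq> 0"
    using assms by (auto simp: slit_half_plane_def power2_eq_1_iff)
  show "1 - of_real y / z\<^sup>2 \<notin> \<real>\<^sub>\<le>\<^sub>0"
  proof
    assume "1 - of_real y / z\<^sup>2 \<in> \<real>\<^sub>\<le>\<^sub>0"
    then obtain s where s: "s \<le> 0" "1 - of_real y / z\<^sup>2 = of_real s"
      by (auto elim: nonpos_Reals_cases)
    from s(2) have "of_real y / z\<^sup>2 = of_real (1 - s)"
      by (simp add: algebra_simps)
    then have "z\<^sup>2 = of_real (y / (1 - s))"
      using z assms(1) s(1) by (simp add: divide_simps split: if_splits)
    moreover have pos: "y / (1 - s) > 0" "y / (1 - s) \<le> y"
      using assms(1) s(1) by (auto simp: divide_simps algebra_simps mult_nonpos_nonneg)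
    ultimately have r: "z \<in> \<real>" "z\<^sup>2 = of_real (y / (1 - s))"
      using in_Reals_if_power2_eq_of_real by blast+
    then have "(Re z)\<^sup>2 = y / (1 - s)"
      by (metis of_real_Re of_real_eq_iff of_real_power)
    with pos have "(Re z)\<^sup>2 \<le> y"
      by simp
    then have "Re z \<le> sqrt y"
      by (rule real_le_rsqrt)
    with assms(2) r(1) show False
      by (auto simp: slit_half_plane_def complex_is_Real_iff)
  qed
qed

lemma line_kernel_holomorphic:
  assumes "0 < y"
  shows "line_kernel a b y holomorphic_on slit_half_plane y"
  unfolding line_kernel_def [abs_def]
  by (intro holomorphic_intros) (use slit_half_plane_facts[OF assms] in \<open>simp_all\<close>)

lemma line_kernel_primitive:
  assumes "0 < y" "y < 1"
  obtains G where "\<And>z. z \<in> slit_half_plane y \<Longrightarrow> (G has_field_derivative line_kernel a b y z) (at z)"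
proof -
  have "\<exists>G. \<forall>z\<in>slit_half_plane y. (G has_field_derivative line_kernel a b y z) (at z)"
  proof (rule holomorphic_starlike_primitive[where k = "{}"])
    show "continuous_on (slit_half_plane y) (line_kernel a b y)"
      by (rule holomorphic_on_imp_continuous_on[OF line_kernel_holomorphic[OF assms(1)]])
    show "line_kernel a b y field_differentiable at z" if "z \<in> slit_half_plane y - {}" for z
      using that line_kernel_holomorphic[OF assms(1)] holomorphic_on_imp_differentiable_at
        open_slit_half_plane by blast
  qed (use assms in \<open>auto intro: open_slit_half_plane starlike_slit_half_plane\<close>)
  then show ?thesis
    using that by blast
qed

lemma norm_exp_mult_square:
  "norm (exp (of_real a * (Complex x u)\<^sup>2)) = exp (a * (x\<^sup>2 - u\<^sup>2))"
  by (simp add: norm_exp_eq_Re Re_power2)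

text \<open>In the sector x \<le> |u| the real part of z^2 is nonpositive, so the exponential is at
  most 1. For |u| \<ge> 2 also |1 - z^2| \<ge> u^2 / 2 and |1 - y / z^2| \<ge> 1/2. The bound does
  not involve x, so it controls long horizontal segments too.\<close>

lemma line_kernel_bound:
  assumes "0 \<le> a" "0 \<le> b" "0 < y" "y < 1" "0 \<le> x" "x \<le> \<bar>u\<bar>" "2 \<le> \<bar>u\<bar>"
  shows "norm (line_kernel a b y (Complex x u)) \<le> 2 * 2 powr b / u\<^sup>2"
proof -
  define z where "z = Complex x u"
  have u: "u\<^sup>2 \<ge> 4"
    using power_mono[OF assms(7), of 2] by simp
  have nz: "norm (z\<^sup>2) = x\<^sup>2 + u\<^sup>2"
    by (simp add: z_def norm_power cmod_power2)
  have "x\<^sup>2 \<le> u\<^sup>2"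
    using power_mono[OF assms(6,5), of 2] by simp
  then have e: "norm (exp (of_real a * z\<^sup>2)) \<le> 1"
    unfolding z_def norm_exp_mult_square using assms(1) by (simp add: mult_nonneg_nonpos)
  have "u\<^sup>2 / 2 \<le> norm (z\<^sup>2) - 1"
    using u nz by simp (use zero_le_power2[of x] in linarith)
  also have "\<dots> \<le> norm (1 - z\<^sup>2)"
    using norm_triangle_ineq2[of "z\<^sup>2" 1] by (simp add: norm_minus_commute)
  finally have d: "u\<^sup>2 / 2 \<le> norm (1 - z\<^sup>2)" .
  have "norm (of_real y / z\<^sup>2) \<le> 1 / 2"
  proof -
    have "2 * y \<le> x\<^sup>2 + u\<^sup>2" "0 < x\<^sup>2 + u\<^sup>2"
      using assms(3,4) u zero_le_power2[of x] by linarith+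
    then show ?thesis
      unfolding norm_divide nz using assms(3) by (simp add: divide_simps mult.commute)
  qed
  then have w: "1 / 2 \<le> norm (1 - of_real y / z\<^sup>2)"
    using norm_triangle_ineq2[of 1 "of_real y / z\<^sup>2"] by simp
  have "norm ((1 - of_real y / z\<^sup>2) powr (- of_real b)) = norm (1 - of_real y / z\<^sup>2) powr (- b)"
    by (simp add: norm_powr_real_powr')
  also have "\<dots> \<le> (1 / 2) powr (- b)"
    using w assms(2) by (intro powr_mono2') auto
  also have "\<dots> = 2 powr b"
    by (simp add: powr_minus powr_divide)
  finally have p: "norm ((1 - of_real y / z\<^sup>2) powr (- of_real b)) \<le> 2 powr b" .
  have "norm (line_kernel a b y z) = norm (exp (of_real a * z\<^sup>2)) *
      norm ((1 - of_real y / z\<^sup>2) powr (- of_real b)) / norm (1 - z\<^sup>2)"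
    by (simp add: line_kernel_def norm_mult norm_divide)
  also have "\<dots> \<le> 1 * 2 powr b / (u\<^sup>2 / 2)"
    using e p d u by (intro frac_le mult_mono) auto
  finally show ?thesis
    by (simp add: z_def mult.commute)
qed

section \<open>Branches along the loop and passage to a vertical line\<close>

text \<open>tau and tau - 1 have the same imaginary part, so off the real axis their arguments both
  lie in (0, pi) or both in (-pi, 0), while for real tau > 1 both are 0. The difference stays in the
  principal range, whence Ln (1 - 1 / tau) = Ln (tau - 1) - Ln tau.\<close>

lemma powr_quotient_shift_one:
  fixes \<tau> :: complex
  assumes "\<tau> \<in> \<real> \<Longrightarrow> 1 < Re \<tau>"
  shows "\<tau> powr of_real (b - 1/2) / (\<tau> - 1) powr of_real b =
    (1 - 1 / \<tau>) powr (- of_real b) / csqrt \<tau>"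
proof -
  have nz: "\<tau> \<noteq> 0" "\<tau> - 1 \<noteq> 0"
    using assms by auto
  have im: "- pi < Im (Ln (\<tau> - 1) - Ln \<tau>) \<and> Im (Ln (\<tau> - 1) - Ln \<tau>) \<le> pi"
  proof (cases "Im \<tau> = 0")
    case True
    then have "\<tau> = of_real (Re \<tau>)" "1 < Re \<tau>"
      using assms by (auto simp: complex_is_Real_iff complex_eq_iff)
    then have "Im (Ln \<tau>) = 0" "Im (Ln (\<tau> - 1)) = 0"
      using nz True by (auto simp: Im_Ln_eq_0)
    then show ?thesis by simp
  next
    case False
    then consider "Im \<tau> > 0" | "Im \<tau> < 0" by linarith
    then show ?thesis
    proof cases
      case 1
      then have "0 < Im (Ln \<tau>)" "Im (Ln \<tau>) < pi" "0 < Im (Ln (\<tau> - 1))" "Im (Ln (\<tau> - 1)) < pi"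
        using nz Im_Ln_pos_lt_imp[of \<tau>] Im_Ln_pos_lt_imp[of "\<tau> - 1"] by auto
      then show ?thesis by simp
    next
      case 2
      then have "\<not> 0 \<le> Im (Ln \<tau>)" "\<not> 0 \<le> Im (Ln (\<tau> - 1))"
        using nz Im_Ln_pos_le[of \<tau>] Im_Ln_pos_le[of "\<tau> - 1"] Im_Ln_le_pi[of \<tau>] Im_Ln_le_pi[of "\<tau> - 1"]
        by auto
      then show ?thesis
        using nz mpi_less_Im_Ln[of \<tau>] mpi_less_Im_Ln[of "\<tau> - 1"] by simp
    qed
  qed
  have "exp (Ln (\<tau> - 1) - Ln \<tau>) = 1 - 1 / \<tau>"
    using nz by (simp add: exp_diff diff_divide_distrib)
  from Ln_unique[OF this] im have ln: "Ln (1 - 1 / \<tau>) = Ln (\<tau> - 1) - Ln \<tau>"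
    by blast
  have "1 - 1 / \<tau> \<noteq> 0"
    using nz by (auto simp: field_simps)
  then have "(1 - 1 / \<tau>) powr (- of_real b) / csqrt \<tau> =
      exp (- of_real b * (Ln (\<tau> - 1) - Ln \<tau>) - Ln \<tau> / 2)"
    using nz by (simp add: powr_def csqrt_exp_Ln ln exp_diff)
  moreover have "\<tau> powr of_real (b - 1/2) / (\<tau> - 1) powr of_real b =
      exp (of_real (b - 1/2) * Ln \<tau> - of_real b * Ln (\<tau> - 1))"
    using nz by (simp add: powr_def exp_diff)
  moreover have "- of_real b * (Ln (\<tau> - 1) - Ln \<tau>) - Ln \<tau> / 2 =
      of_real (b - 1/2) * Ln \<tau> - of_real b * Ln (\<tau> - 1)"
    by (simp add: algebra_simps)
  ultimately show ?thesis
    by simp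
qed

declare csqrt.simps [simp del]

lemma csqrt_polar:
  "Re (csqrt z) = sqrt (norm z) * cos (Arg z / 2)"
  "Im (csqrt z) = sqrt (norm z) * sin (Arg z / 2)"
proof -
  have "exp (ln (norm z) / 2) = sqrt (norm z)" if "z \<noteq> 0"
    using that by (simp flip: ln_sqrt)
  then show "Re (csqrt z) = sqrt (norm z) * cos (Arg z / 2)" "Im (csqrt z) = sqrt (norm z) * sin (Arg z / 2)"
    by (cases "z = 0"; simp add: csqrt_exp_Ln Re_exp Im_exp Arg_eq_Im_Ln)+
qed

text \<open>The argument of the square root tends to pi/2 in absolute value, so its cosine tends to
  0 and its sine to 1 in absolute value; 1/2 separates them. This puts the ends of the transformed
  contour into the sector of \<open>line_kernel_bound\<close>.\<close>

lemma csqrt_Re_le_abs_Im_eventually: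
  fixes \<gamma> :: "'a :: t2_space \<Rightarrow> complex"
  assumes "((\<lambda>t. \<bar>Arg (\<gamma> t)\<bar>) \<longlongrightarrow> pi) F"
  shows "\<forall>\<^sub>F t in F. Re (csqrt (\<gamma> t)) \<le> \<bar>Im (csqrt (\<gamma> t))\<bar>"
proof -
  have "((\<lambda>t. cos (\<bar>Arg (\<gamma> t)\<bar> / 2)) \<longlongrightarrow> cos (pi / 2)) F"
    by (intro tendsto_cos tendsto_divide assms tendsto_const) simp
  then have 1: "\<forall>\<^sub>F t in F. cos (\<bar>Arg (\<gamma> t)\<bar> / 2) < 1 / 2"
    by (rule order_tendstoD) simp
  have "((\<lambda>t. sin (\<bar>Arg (\<gamma> t)\<bar> / 2)) \<longlongrightarrow> sin (pi / 2)) F"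
    by (intro tendsto_sin tendsto_divide assms tendsto_const) simp
  then have 2: "\<forall>\<^sub>F t in F. sin (\<bar>Arg (\<gamma> t)\<bar> / 2) > 1 / 2"
    by (rule order_tendstoD) simp
  from 1 2 show ?thesis
  proof eventually_elim
    case (elim t)
    have "cos (Arg (\<gamma> t) / 2) = cos (\<bar>Arg (\<gamma> t)\<bar> / 2)"
      by (simp add: abs_if)
    moreover have "\<bar>sin (Arg (\<gamma> t) / 2)\<bar> = \<bar>sin (\<bar>Arg (\<gamma> t)\<bar> / 2)\<bar>"
      by (simp add: abs_if)
    ultimately have "cos (Arg (\<gamma> t) / 2) \<le> \<bar>sin (Arg (\<gamma> t) / 2)\<bar>"
      using elim by linarith
    then show ?case
      by (simp add: csqrt_polar abs_mult mult_left_mono)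
  qed
qed

text \<open>The half angles tend to pi/2 and -pi/2 while the modulus grows. The transformed contour
  thus runs upwards, which fixes the orientation of the vertical line.\<close>

lemma loop_contour_csqrt_Im:
  assumes "loop_contour y \<gamma>"
  shows "filterlim (\<lambda>t. Im (csqrt (\<gamma> t))) at_top at_top" "filterlim (\<lambda>t. Im (csqrt (\<gamma> t))) at_bot at_bot"
proof -
  have L: "filterlim \<gamma> at_infinity at_bot" "filterlim \<gamma> at_infinity at_top"
    "((\<lambda>t. Arg (\<gamma> t)) \<longlongrightarrow> - pi) at_bot" "((\<lambda>t. Arg (\<gamma> t)) \<longlongrightarrow> pi) at_top"
    using assms by (auto simp: loop_contour_def)
  have n: "filterlim (\<lambda>t. sqrt (norm (\<gamma> t))) at_top F" if "filterlim \<gamma> at_infinity F" for F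
    using that by (intro filterlim_compose[OF sqrt_at_top]) (simp add: filterlim_at_infinity_conv_norm_at_top)
  have "((\<lambda>t. sin (Arg (\<gamma> t) / 2)) \<longlongrightarrow> sin (pi / 2)) at_top"
    using L by (intro tendsto_intros) auto
  from filterlim_tendsto_pos_mult_at_top[OF this _ n[OF L(2)]]
  show "filterlim (\<lambda>t. Im (csqrt (\<gamma> t))) at_top at_top"
    by (simp add: csqrt_polar mult.commute)
  have "((\<lambda>t. sin (Arg (\<gamma> t) / 2)) \<longlongrightarrow> sin (- pi / 2)) at_bot"
    using L by (intro tendsto_intros) auto
  from filterlim_tendsto_neg_mult_at_bot[OF this _ n[OF L(1)]]
  show "filterlim (\<lambda>t. Im (csqrt (\<gamma> t))) at_bot at_bot"
    by (simp add: csqrt_polar mult.commute)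
qed

lemma loop_contour_csqrt_in_slit_half_plane:
  assumes "loop_contour y \<gamma>" "0 < y" "y < 1"
  shows "\<gamma> t \<notin> \<real>\<^sub>\<le>\<^sub>0" "of_real (sqrt y) * csqrt (\<gamma> t) \<in> slit_half_plane y"
proof -
  have real: "1 < Re (\<gamma> t) \<and> Re (\<gamma> t) < 1 / y" if "\<gamma> t \<in> \<real>"
    using assms(1) that by (auto simp: loop_contour_def)
  show nonpos: "\<gamma> t \<notin> \<real>\<^sub>\<le>\<^sub>0"
    using real by (auto elim!: nonpos_Reals_cases)
  \<comment> \<open>A principal square root with real part 0 would have a nonpositive real square,
    excluded by \<open>nonpos\<close>.\<close>
  have pos: "0 < Re (csqrt (\<gamma> t))"
    using Re_csqrt[of "\<gamma> t"] nonpos csqrt_principal[of "\<gamma> t"] power2_csqrt[of "\<gamma> t"]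
    by (smt (verit, best) complex_nonpos_Reals_iff cmod_power2 csqrt_eq_0 Re_power2 Im_power2 mult_eq_0_iff
        zero_le_power2 power2_eq_square zero_less_power2)
  have "sqrt y < sqrt y * Re (csqrt (\<gamma> t)) \<and> sqrt y * Re (csqrt (\<gamma> t)) < 1"
    if im: "Im (csqrt (\<gamma> t)) = 0"
  proof -
    have "csqrt (\<gamma> t) = of_real (Re (csqrt (\<gamma> t)))"
      using im by (simp add: complex_eq_iff)
    then have "\<gamma> t = of_real ((Re (csqrt (\<gamma> t)))\<^sup>2)"
      by (metis of_real_power power2_csqrt)
    then have "1 < (Re (csqrt (\<gamma> t)))\<^sup>2" "(Re (csqrt (\<gamma> t)))\<^sup>2 < 1 / y"
      using real by (metis Re_complex_of_real Reals_of_real)+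
    then have "1 < Re (csqrt (\<gamma> t))" "Re (csqrt (\<gamma> t)) < sqrt (1 / y)"
      using pos by (auto simp: real_less_rsqrt intro: power2_less_imp_less[of 1])
    then show ?thesis
      using assms by (simp add: real_sqrt_divide field_simps)
  qed
  then show "of_real (sqrt y) * csqrt (\<gamma> t) \<in> slit_half_plane y"
    using pos assms by (auto simp: slit_half_plane_def)
qed

text \<open>With \<open>G\<close> a primitive of the kernel on the slit half plane, \<open>G\<close>
  composed with \<open>\<zeta>\<close> is a primitive of the loop integrand along the contour. Its
  values are compared with those of \<open>G\<close> on the line at equal height.\<close>

lemma loop_contour_integral_eq_line_integral:
  fixes a b y c :: real and \<gamma> :: "real \<Rightarrow> complex"
  assumes a: "0 \<le> a" and b: "0 \<le> b" and y: "0 < y" "y < 1" and L: "loop_contour y \<gamma>"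
    and c: "sqrt y < c" "c < 1"
    and I: "((\<lambda>u. line_kernel a b y (Complex c u)) has_integral I) UNIV"
  shows "((\<lambda>t. of_real (sqrt y) / 2 * (exp (of_real (a * y) * \<gamma> t) *
      (\<gamma> t powr of_real (b - 1/2) / ((\<gamma> t - 1) powr of_real b * (1 - of_real y * \<gamma> t))) *
      vector_derivative \<gamma> (at t))) has_integral \<i> * I) UNIV"
proof -
  obtain G where G: "\<And>z. z \<in> slit_half_plane y \<Longrightarrow> (G has_field_derivative line_kernel a b y z) (at z)"
    using line_kernel_primitive[OF y] by blast
  define \<zeta> where "\<zeta> z = of_real (sqrt y) * csqrt z" for z
  have c0: "0 < c"
    using c(1) real_sqrt_gt_zero[OF y(1)] by linarith
  have slit: "\<zeta> (\<gamma> t) \<in> slit_half_plane y" and nonpos: "\<gamma> t \<notin> \<real>\<^sub>\<le>\<^sub>0" for t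
    using loop_contour_csqrt_in_slit_half_plane[OF L y] by (auto simp: \<zeta>_def)
  have Gdiff: "((\<lambda>z. G (\<zeta> z)) has_field_derivative
      line_kernel a b y (\<zeta> (\<gamma> t)) * (of_real (sqrt y) * (1 / (2 * csqrt (\<gamma> t))))) (at (\<gamma> t))" for t
  proof -
    have "(\<zeta> has_field_derivative of_real (sqrt y) * (1 / (2 * csqrt (\<gamma> t)))) (at (\<gamma> t))"
      unfolding \<zeta>_def [abs_def] by (intro DERIV_cmult) (use nonpos in \<open>auto intro!: derivative_eq_intros\<close>)
    from DERIV_chain2[OF G[OF slit] this] show ?thesis .
  qed
  define f where "f z = of_real (sqrt y) / 2 * (exp (of_real (a * y) * z) *
      (z powr of_real (b - 1/2) / ((z - 1) powr of_real b * (1 - of_real y * z))))" for z :: complex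
  have f_eq: "line_kernel a b y (\<zeta> (\<gamma> t)) * (of_real (sqrt y) * (1 / (2 * csqrt (\<gamma> t)))) = f (\<gamma> t)" for t
  proof -
    have "(\<zeta> (\<gamma> t))\<^sup>2 = of_real y * \<gamma> t"
      using y by (simp add: \<zeta>_def power_mult_distrib flip: of_real_power)
    then have "line_kernel a b y (\<zeta> (\<gamma> t)) * (of_real (sqrt y) * (1 / (2 * csqrt (\<gamma> t)))) =
        of_real (sqrt y) / 2 * (exp (of_real (a * y) * \<gamma> t) *
          ((1 - 1 / \<gamma> t) powr (- of_real b) / csqrt (\<gamma> t) / (1 - of_real y * \<gamma> t)))"
      using y by (simp add: line_kernel_def mult_ac)
    also have "(1 - 1 / \<gamma> t) powr (- of_real b) / csqrt (\<gamma> t) =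
        \<gamma> t powr of_real (b - 1/2) / (\<gamma> t - 1) powr of_real b"
      using L by (intro powr_quotient_shift_one[symmetric]) (auto simp: loop_contour_def)
    finally show ?thesis
      by (simp add: f_def)
  qed
  have GI: "((\<lambda>t. f (\<gamma> t) * vector_derivative \<gamma> (at t)) has_integral G (\<zeta> (\<gamma> r)) - G (\<zeta> (\<gamma> l))) {l..r}"
    if lr: "l \<le> r" for l r
  proof -
    have pw: "\<gamma> piecewise_C1_differentiable_on {l..r}"
      using L by (auto simp: loop_contour_def)
    then obtain S where S: "finite S" "continuous_on {l..r} \<gamma>" "\<gamma> C1_differentiable_on ({l..r} - S)"
      by (auto simp: piecewise_C1_differentiable_on_def)
    show ?thesis
    proof (rule fundamental_theorem_of_calculus_interior_strong[OF S(1) lr])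
      fix t assume "t \<in> {l<..<r} - S"
      then have "\<gamma> differentiable at t"
        using S(3) by (auto simp: C1_differentiable_on_eq)
      then have "(\<gamma> has_vector_derivative vector_derivative \<gamma> (at t)) (at t)"
        by (simp add: vector_derivative_works)
      from field_vector_diff_chain_at[OF this Gdiff]
      show "((\<lambda>t. G (\<zeta> (\<gamma> t))) has_vector_derivative f (\<gamma> t) * vector_derivative \<gamma> (at t)) (at t)"
        unfolding f_eq by (simp add: o_def mult.commute)
    next
      have "continuous_on (\<gamma> ` {l..r}) (\<lambda>z. G (\<zeta> z))"
        using DERIV_isCont[OF Gdiff] by (intro continuous_at_imp_continuous_on) blast
      from continuous_on_compose2[OF this S(2)] show "continuous_on {l..r} (\<lambda>t. G (\<zeta> (\<gamma> t)))"
        by auto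
    qed
  qed
  define v where "v t = Im (\<zeta> (\<gamma> t))" for t
  have v: "filterlim v at_top at_top" "filterlim v at_bot at_bot"
    using filterlim_tendsto_pos_mult_at_top[OF tendsto_const[of "sqrt y"] _ loop_contour_csqrt_Im(1)[OF L]]
      filterlim_tendsto_pos_mult_at_bot[OF tendsto_const[of "sqrt y"] _ loop_contour_csqrt_Im(2)[OF L]] y
    by (auto simp: v_def [abs_def] \<zeta>_def)
  \<comment> \<open>The horizontal segment to the line has length at most |v t|, possibly unbounded,
    but the kernel on it is of order 1 / (v t)^2, so the difference is of order 1 / |v t|.\<close>
  have lim: "((\<lambda>t. G (\<zeta> (\<gamma> t)) - G (Complex c (v t))) \<longlongrightarrow> 0) F"
    if F: "filterlim (\<lambda>t. \<bar>v t\<bar>) at_top F" "((\<lambda>t. \<bar>Arg (\<gamma> t)\<bar>) \<longlongrightarrow> pi) F" for F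
  proof (rule Lim_null_comparison)
    have "\<forall>\<^sub>F t in F. \<bar>v t\<bar> \<ge> 2"
      using F(1) by (simp add: filterlim_at_top)
    with csqrt_Re_le_abs_Im_eventually[OF F(2)]
    show "\<forall>\<^sub>F t in F. norm (G (\<zeta> (\<gamma> t)) - G (Complex c (v t))) \<le> 2 * 2 powr b * inverse \<bar>v t\<bar>"
    proof eventually_elim
      case (elim t)
      define x where "x = Re (\<zeta> (\<gamma> t))"
      have x: "0 < x" "x \<le> \<bar>v t\<bar>"
        using slit[of t] elim(1) y
        by (auto simp: x_def v_def \<zeta>_def slit_half_plane_def abs_mult mult_left_mono)
      have "Complex x (v t) = \<zeta> (\<gamma> t)"
        by (simp add: x_def v_def)
      moreover have "norm (G (Complex x (v t)) - G (Complex c (v t))) \<le> 2 * 2 powr b / (v t)\<^sup>2 * \<bar>x - c\<bar>"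
      proof (rule horizontal_increment_bound[where \<phi> = "line_kernel a b y"])
        fix s assume "s \<in> closed_segment x c"
        then have s: "0 < s" "s \<le> \<bar>v t\<bar>"
          using x c c0 elim(2) by (auto simp: closed_segment_eq_real_ivl split: if_splits)
        show "(G has_field_derivative line_kernel a b y (Complex s (v t))) (at (Complex s (v t)))"
          using s elim(2) by (intro G) (auto simp: slit_half_plane_def)
        show "norm (line_kernel a b y (Complex s (v t))) \<le> 2 * 2 powr b / (v t)\<^sup>2"
          using s elim(2) a b y by (intro line_kernel_bound) auto
      qed
      moreover have "2 * 2 powr b / (v t)\<^sup>2 * \<bar>x - c\<bar> \<le> 2 * 2 powr b / (v t)\<^sup>2 * \<bar>v t\<bar>"
        using x c c0 elim(2) by (intro mult_left_mono) auto
      moreover have "2 * 2 powr b / (v t)\<^sup>2 * \<bar>v t\<bar> = 2 * 2 powr b * inverse \<bar>v t\<bar>"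
      proof -
        have "k / r\<^sup>2 * r = k * inverse r" if "r > 0" for k r :: real
          using that by (simp add: power2_eq_square divide_simps)
        from this[of "\<bar>v t\<bar>"] show ?thesis
          using elim(2) by simp
      qed
      ultimately show ?case
        by simp
    qed
    show "((\<lambda>t. 2 * 2 powr b * inverse \<bar>v t\<bar>) \<longlongrightarrow> 0) F"
      by (intro tendsto_mult_right_zero tendsto_inverse_0_at_top F)
  qed
  have line: "Complex c u \<in> slit_half_plane y" for u
    using c c0 by (simp add: slit_half_plane_def)
  have arg: "((\<lambda>t. \<bar>Arg (\<gamma> t)\<bar>) \<longlongrightarrow> pi) at_top" "((\<lambda>t. \<bar>Arg (\<gamma> t)\<bar>) \<longlongrightarrow> pi) at_bot"
    using tendsto_rabs[of "\<lambda>t. Arg (\<gamma> t)" pi at_top] tendsto_rabs[of "\<lambda>t. Arg (\<gamma> t)" "- pi" at_bot] L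
    by (auto simp: loop_contour_def)
  have abs_at_bot: "filterlim (\<lambda>t::real. \<bar>t\<bar>) at_top at_bot"
    using filterlim_abs_real by (simp add: filterlim_at_bot_mirror)
  have "((\<lambda>t. f (\<gamma> t) * vector_derivative \<gamma> (at t)) has_integral \<i> * I) UNIV"
  proof (rule has_integral_UNIV_transfer[where v = v and F = "\<lambda>u. G (Complex c u)"])
    show "((\<lambda>u. \<i> * line_kernel a b y (Complex c u)) has_integral \<i> * I) UNIV"
      by (intro has_integral_mult_right I)
    show "((\<lambda>u. \<i> * line_kernel a b y (Complex c u)) has_integral G (Complex c r) - G (Complex c l)) {l..r}"
      if "l \<le> r" for l r
      using that by (intro has_integral_vertical_segment G line)
    show "((\<lambda>t. G (\<zeta> (\<gamma> t)) - G (Complex c (v t))) \<longlongrightarrow> 0) at_bot"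
      by (intro lim arg filterlim_compose[OF abs_at_bot v(2)])
    show "((\<lambda>t. G (\<zeta> (\<gamma> t)) - G (Complex c (v t))) \<longlongrightarrow> 0) at_top"
      by (intro lim arg filterlim_compose[OF filterlim_abs_real v(1)])
  qed (use GI v in auto)
  then show ?thesis
    by (simp add: f_def mult.assoc)
qed

section \<open>Gaussian and complementary error integrals\<close>

lemma integrable_inverse_one_plus_square: "integrable lborel (\<lambda>u::real. inverse (1 + u\<^sup>2))"
  using integrable_inverse_1_plus_square by (simp add: set_integrable_def)

lemma integrable_if_quadratic_decay:
  fixes f :: "real \<Rightarrow> complex"
  assumes "continuous_on UNIV f" "\<And>u. norm (f u) \<le> C * inverse (1 + u\<^sup>2)"
  shows "integrable lborel f"
proof (rule Bochner_Integration.integrable_bound)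
  show "integrable lborel (\<lambda>u::real. C * inverse (1 + u\<^sup>2))"
    by (intro integrable_mult_right integrable_inverse_one_plus_square)
  show "f \<in> borel_measurable lborel"
    using assms(1) by (simp add: borel_measurable_continuous_onI)
  show "AE u in lborel. norm (f u) \<le> norm (C * inverse (1 + u\<^sup>2))"
    unfolding real_norm_def by (intro AE_I2 order_trans[OF assms(2) abs_ge_self])
qed

text \<open>The real part 1 - x^2 + u^2 already suffices, since x^2 \<le> c^2 \<le> c. The bound is
  uniform over the strip |x| \<le> c.\<close>

lemma norm_one_minus_square_ge:
  assumes "0 \<le> c" "c < 1" "\<bar>x\<bar> \<le> c"
  shows "(1 - c) * (1 + u\<^sup>2) \<le> norm (1 - (Complex x u)\<^sup>2)"
proof -
  have "x\<^sup>2 \<le> c\<^sup>2"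
    using assms power_mono[of "\<bar>x\<bar>" c 2] by simp
  moreover have "c\<^sup>2 \<le> c"
    using assms mult_left_mono[of c 1 c] by (simp add: power2_eq_square)
  moreover have "0 \<le> c * u\<^sup>2"
    using assms by simp
  ultimately have "(1 - c) * (1 + u\<^sup>2) \<le> 1 - x\<^sup>2 + u\<^sup>2"
    by (simp add: algebra_simps)
  also have "\<dots> = Re (1 - (Complex x u)\<^sup>2)"
    by (simp add: Re_power2)
  also have "\<dots> \<le> norm (1 - (Complex x u)\<^sup>2)"
    by (rule complex_Re_le_cmod)
  finally show ?thesis .
qed

lemma exp_square_over_one_minus_square_bound:
  assumes "0 \<le> a" "0 \<le> c" "c < 1" "\<bar>x\<bar> \<le> c"
  shows "norm (exp (of_real a * (Complex x u)\<^sup>2) / (1 - (Complex x u)\<^sup>2))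
    \<le> exp (a * c\<^sup>2) / (1 - c) * inverse (1 + u\<^sup>2)"
proof -
  have "x\<^sup>2 \<le> c\<^sup>2"
    using assms power_mono[of "\<bar>x\<bar>" c 2] by simp
  then have "a * (x\<^sup>2 - u\<^sup>2) \<le> a * c\<^sup>2"
    using assms(1) zero_le_power2[of u] by (intro mult_left_mono) linarith+
  moreover have "0 < 1 + u\<^sup>2"
    by (simp add: add_pos_nonneg)
  ultimately have "exp (a * (x\<^sup>2 - u\<^sup>2)) / norm (1 - (Complex x u)\<^sup>2)
      \<le> exp (a * c\<^sup>2) / ((1 - c) * (1 + u\<^sup>2))"
    using assms by (intro frac_le norm_one_minus_square_ge) auto
  then show ?thesis
    unfolding norm_divide norm_exp_mult_square by (simp add: divide_inverse mult.assoc)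
qed

lemma one_minus_square_nonzero:
  assumes "\<bar>Re z\<bar> < 1"
  shows "1 - z\<^sup>2 \<noteq> (0 :: complex)"
  using assms by (auto simp: power2_eq_1_iff)

lemma gaussian_has_bochner_integral:
  fixes s :: real
  assumes "s > 0"
  shows "has_bochner_integral lborel (\<lambda>u. exp (- (s\<^sup>2 * u\<^sup>2))) (sqrt pi / s)"
proof -
  \<comment> \<open>The standard deviation for which the normal density has exponent -(s^2
    u^2).\<close>
  define \<sigma> where "\<sigma> = 1 / (s * sqrt 2)"
  have \<sigma>: "\<sigma> > 0" "2 * \<sigma>\<^sup>2 = 1 / s\<^sup>2"
    using assms by (auto simp: \<sigma>_def power_divide power_mult_distrib)
  have "has_bochner_integral lborel (normal_density 0 \<sigma>) 1"
    using \<sigma>(1) by (simp add: has_bochner_integral_iff)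
  then have "has_bochner_integral lborel (\<lambda>u. (sqrt pi / s) * normal_density 0 \<sigma> u) ((sqrt pi / s) * 1)"
    by (rule has_bochner_integral_mult_right)
  moreover have "(sqrt pi / s) * normal_density 0 \<sigma> u = exp (- (s\<^sup>2 * u\<^sup>2))" for u
  proof -
    have "sqrt (2 * pi * \<sigma>\<^sup>2) = sqrt (pi * (2 * \<sigma>\<^sup>2))"
      by (simp add: mult_ac)
    also have "\<dots> = sqrt pi / s"
      unfolding \<sigma>(2) using assms by (simp add: real_sqrt_divide)
    finally show ?thesis
      using assms by (simp add: normal_density_def \<sigma>(2) mult.commute)
  qed
  ultimately show ?thesis by simp
qed

lemma gaussian_nn_integral:
  fixes s :: real
  assumes "s > 0"
  shows "(\<integral>\<^sup>+u. ennreal (exp (- (s\<^sup>2 * u\<^sup>2))) \<partial>lborel) = ennreal (sqrt pi / s)"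
  using gaussian_has_bochner_integral[OF assms]
  by (simp add: nn_integral_eq_integral has_bochner_integral_iff)

lemma erfc_nn_integral:
  "(\<integral>\<^sup>+s. ennreal (exp (- (s\<^sup>2))) * indicator {d..} s \<partial>lborel) = ennreal (sqrt pi / 2 * erfc d)"
proof -
  have "integrable lborel (\<lambda>s::real. exp (- (s\<^sup>2)))"
    using gaussian_has_bochner_integral[of 1] by (simp add: has_bochner_integral_iff)
  then have int: "set_integrable lborel {d..} (\<lambda>s. exp (- (s\<^sup>2)))"
    unfolding set_integrable_def by (intro integrable_mult_indicator) auto
  then have "integral {d..} (\<lambda>s. exp (- (s\<^sup>2))) = (\<integral>s. indicator {d..} s *\<^sub>R exp (- (s\<^sup>2)) \<partial>lborel)"
    using set_borel_integral_eq_integral(2) unfolding set_lebesgue_integral_def by metis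
  also have "ennreal \<dots> = (\<integral>\<^sup>+s. ennreal (indicator {d..} s *\<^sub>R exp (- (s\<^sup>2))) \<partial>lborel)"
    using int unfolding set_integrable_def by (intro nn_integral_eq_integral[symmetric]) auto
  also have "\<dots> = (\<integral>\<^sup>+s. ennreal (exp (- (s\<^sup>2))) * indicator {d..} s \<partial>lborel)"
    by (intro nn_integral_cong) (simp add: indicator_def)
  finally show ?thesis
    by (simp add: erfc_def)
qed

lemma erfc_nonneg: "0 \<le> erfc d"
  unfolding erfc_def
  \<comment> \<open>In the non-integrable case the integral is 0 by default, so no integrability
    proof is needed here.\<close>
  by (cases "(\<lambda>t::real. exp (- (t\<^sup>2))) integrable_on {d..}")
    (auto simp: not_integrable_integral intro!: divide_nonneg_nonneg mult_nonneg_nonneg integral_nonneg)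

text \<open>Writing \<open>exp (- d\<^sup>2 (1 + u\<^sup>2)) / (1 + u\<^sup>2)\<close> as an integral over \<open>s \<ge> d\<close> and exchanging
  the integrals leaves a Gaussian integral in \<open>u\<close>.\<close>

lemma erfc_lorentz_integral:
  assumes "0 \<le> d"
  shows "((\<lambda>u. exp (- (d\<^sup>2 * u\<^sup>2)) / (1 + u\<^sup>2)) has_integral pi * (exp (d\<^sup>2) * erfc d)) UNIV"
proof -
  have pos: "0 < 1 + u\<^sup>2" for u :: real
    by (simp add: add_pos_nonneg)
  have inner: "(\<integral>\<^sup>+s. ennreal (2 * s * exp (- (s\<^sup>2 * (1 + u\<^sup>2)))) * indicator {d..} s \<partial>lborel) =
      ennreal (exp (- (d\<^sup>2 * (1 + u\<^sup>2))) / (1 + u\<^sup>2))" for u :: real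
  proof -
    have "((\<lambda>s. - (exp (- (s\<^sup>2 * (1 + u\<^sup>2))) / (1 + u\<^sup>2))) \<longlongrightarrow> - (0 / (1 + u\<^sup>2))) at_top"
      using pos[of u]
      by (intro tendsto_intros filterlim_compose[OF exp_at_bot]
          filterlim_compose[OF filterlim_uminus_at_bot_at_top]
          filterlim_at_top_mult_tendsto_pos[OF tendsto_const] filterlim_pow_at_top filterlim_ident) auto
    then have "(\<integral>\<^sup>+s. ennreal (2 * s * exp (- (s\<^sup>2 * (1 + u\<^sup>2)))) * indicator {d..} s \<partial>lborel) =
        ennreal (0 - (- (exp (- (d\<^sup>2 * (1 + u\<^sup>2))) / (1 + u\<^sup>2))))"
      using assms pos[of u]
      by (intro nn_integral_FTC_atLeast)
        (auto intro!: derivative_eq_intros simp: divide_simps)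
    then show ?thesis by simp
  qed
  have "(\<integral>\<^sup>+u. ennreal (exp (- (d\<^sup>2 * (1 + u\<^sup>2))) / (1 + u\<^sup>2)) \<partial>lborel) =
      (\<integral>\<^sup>+u. \<integral>\<^sup>+s. ennreal (2 * s * exp (- (s\<^sup>2 * (1 + u\<^sup>2)))) * indicator {d..} s \<partial>lborel \<partial>lborel)"
    by (simp add: inner)
  also have "\<dots> = (\<integral>\<^sup>+s. \<integral>\<^sup>+u. ennreal (2 * s * exp (- (s\<^sup>2 * (1 + u\<^sup>2)))) * indicator {d..} s \<partial>lborel \<partial>lborel)"
    by (rule lborel_pair.Fubini') measurable
  also have "\<dots> = (\<integral>\<^sup>+s. ennreal (2 * sqrt pi) * (ennreal (exp (- (s\<^sup>2))) * indicator {d..} s) \<partial>lborel)"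
  proof (intro nn_integral_cong_AE)
    show "AE s in lborel. (\<integral>\<^sup>+u. ennreal (2 * s * exp (- (s\<^sup>2 * (1 + u\<^sup>2)))) * indicator {d..} s \<partial>lborel) =
        ennreal (2 * sqrt pi) * (ennreal (exp (- (s\<^sup>2))) * indicator {d..} s)"
      \<comment> \<open>When d = 0 the range includes s = 0, where the inner Gaussian is not
        integrable; this single point is discarded.\<close>
      using AE_lborel_singleton[of 0]
    proof eventually_elim
      case (elim s)
      show ?case
      proof (cases "d \<le> s")
        case True
        then have s: "s > 0"
          using elim assms by simp
        have "(\<integral>\<^sup>+u. ennreal (2 * s * exp (- (s\<^sup>2 * (1 + u\<^sup>2)))) \<partial>lborel) =
            (\<integral>\<^sup>+u. ennreal (2 * s * exp (- (s\<^sup>2))) * ennreal (exp (- (s\<^sup>2 * u\<^sup>2))) \<partial>lborel)"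
          using s by (intro nn_integral_cong)
            (simp add: ring_distribs exp_add [symmetric] mult.assoc flip: ennreal_mult)
        also have "\<dots> = ennreal (2 * s * exp (- (s\<^sup>2))) * ennreal (sqrt pi / s)"
          using s by (simp add: nn_integral_cmult gaussian_nn_integral)
        also have "\<dots> = ennreal (2 * sqrt pi) * ennreal (exp (- (s\<^sup>2)))"
          using s by (simp add: field_simps flip: ennreal_mult)
        finally show ?thesis
          using True by simp
      qed simp
    qed
  qed
  also have "\<dots> = ennreal (2 * sqrt pi) * ennreal (sqrt pi / 2 * erfc d)"
    by (subst nn_integral_cmult) (auto simp: erfc_nn_integral)
  also have "\<dots> = ennreal (pi * erfc d)"
    using erfc_nonneg[of d] by (simp flip: ennreal_mult)
  finally have nn: "(\<integral>\<^sup>+u. ennreal (exp (- (d\<^sup>2 * (1 + u\<^sup>2))) / (1 + u\<^sup>2)) \<partial>lborel) = ennreal (pi * erfc d)" .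
  have "((\<lambda>u. exp (- (d\<^sup>2 * (1 + u\<^sup>2))) / (1 + u\<^sup>2)) has_integral pi * erfc d) UNIV"
    by (rule nn_integral_has_integral[OF _ _ nn]) (use pos erfc_nonneg in \<open>auto simp: less_imp_le\<close>)
  from has_integral_mult_right[OF this, of "exp (d\<^sup>2)"] show ?thesis
    by (simp add: ring_distribs exp_add [symmetric] mult_ac flip: exp_add)
qed

section \<open>Integrals along vertical lines\<close>

text \<open>On the imaginary axis z^2 = -u^2, so the exponential and rational factors become real.
  The open strip |Re z| < 1 is convex and avoids the poles 1 and -1 of 1 / (1 - z^2).\<close>

lemma vertical_line_shift_from_imaginary_axis:
  assumes "\<phi> holomorphic_on {z. \<bar>Re z\<bar> < 1}" and c: "0 \<le> c" "c < 1"
    and "((\<lambda>u. \<phi> (Complex 0 u)) has_integral I) UNIV"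
    and "\<And>x u. \<bar>x\<bar> \<le> c \<Longrightarrow> norm (\<phi> (Complex x u)) \<le> B u"
    and "(B \<longlongrightarrow> 0) at_bot" "(B \<longlongrightarrow> 0) at_top"
  shows "((\<lambda>u. \<phi> (Complex c u)) has_integral I) UNIV"
proof (rule vertical_line_shift[OF assms(1) _ _ _ _ assms(4)])
  have "{z. \<bar>Re z\<bar> < 1} = {z. Re z < 1} \<inter> {z. Re z > - 1}"
    by auto
  then show "open {z. \<bar>Re z\<bar> < 1}" "convex {z. \<bar>Re z\<bar> < 1}"
    by (simp_all add: open_Int open_halfspace_Re_lt open_halfspace_Re_gt
        convex_Int convex_halfspace_Re_lt convex_halfspace_Re_gt)
  show "norm (\<phi> (Complex x u)) \<le> B u" if "x \<in> closed_segment 0 c" for x u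
    using that c by (intro assms(5)) (auto simp: closed_segment_eq_real_ivl)
qed (use assms in auto)

lemma of_real_has_integral_complex:
  fixes f :: "real \<Rightarrow> real"
  assumes "(f has_integral I) S"
  shows "((\<lambda>u. complex_of_real (f u)) has_integral of_real I) S"
  using has_integral_linear[OF assms bounded_linear_of_real] by (simp add: o_def)

lemma gaussian_vertical_line:
  assumes "0 < d" "0 \<le> c" "c < 1"
  shows "((\<lambda>u. exp (of_real (d\<^sup>2) * (Complex c u)\<^sup>2)) has_integral of_real (sqrt pi / d)) UNIV"
proof (rule vertical_line_shift_from_imaginary_axis[OF _ assms(2,3)])
  have "((\<lambda>u. exp (- (d\<^sup>2 * u\<^sup>2))) has_integral sqrt pi / d) UNIV"
    using gaussian_has_bochner_integral[OF assms(1)]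
    by (metis has_bochner_integral_iff has_integral_integral_lborel)
  from of_real_has_integral_complex[OF this]
  show "((\<lambda>u. exp (of_real (d\<^sup>2) * (Complex 0 u)\<^sup>2)) has_integral of_real (sqrt pi / d)) UNIV"
    by (simp add: Complex_eq power_mult_distrib exp_of_real [symmetric])
  show "norm (exp (of_real (d\<^sup>2) * (Complex x u)\<^sup>2)) \<le> exp (d\<^sup>2 * c\<^sup>2) * exp (- (d\<^sup>2 * u\<^sup>2))"
    if "\<bar>x\<bar> \<le> c" for x u
  proof -
    have "x\<^sup>2 \<le> c\<^sup>2"
      using that power_mono[of "\<bar>x\<bar>" c 2] by simp
    then have "d\<^sup>2 * x\<^sup>2 \<le> d\<^sup>2 * c\<^sup>2"
      by (intro mult_left_mono) auto
    then show ?thesis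
      unfolding norm_exp_mult_square exp_add[symmetric] by (simp add: algebra_simps)
  qed
  have top: "((\<lambda>u. exp (d\<^sup>2 * c\<^sup>2) * exp (- (d\<^sup>2 * u\<^sup>2))) \<longlongrightarrow> 0) at_top"
    using assms(1)
    by (intro tendsto_mult_right_zero filterlim_compose[OF exp_at_bot]
        filterlim_compose[OF filterlim_uminus_at_bot_at_top]
        filterlim_tendsto_pos_mult_at_top[OF tendsto_const] filterlim_pow_at_top filterlim_ident) auto
  then show "((\<lambda>u. exp (d\<^sup>2 * c\<^sup>2) * exp (- (d\<^sup>2 * u\<^sup>2))) \<longlongrightarrow> 0) at_bot"
    by (simp add: filterlim_at_bot_mirror)
  from top show "((\<lambda>u. exp (d\<^sup>2 * c\<^sup>2) * exp (- (d\<^sup>2 * u\<^sup>2))) \<longlongrightarrow> 0) at_top" .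
qed (auto intro!: holomorphic_intros)

lemma erfc_vertical_line:
  assumes "0 \<le> d" "0 \<le> c" "c < 1"
  shows "((\<lambda>u. exp (of_real (d\<^sup>2) * (Complex c u)\<^sup>2) / (1 - (Complex c u)\<^sup>2)) has_integral
    of_real (pi * (exp (d\<^sup>2) * erfc d))) UNIV"
proof (rule vertical_line_shift_from_imaginary_axis[OF _ assms(2,3)])
  from of_real_has_integral_complex[OF erfc_lorentz_integral[OF assms(1)]]
  show "((\<lambda>u. exp (of_real (d\<^sup>2) * (Complex 0 u)\<^sup>2) / (1 - (Complex 0 u)\<^sup>2)) has_integral
      of_real (pi * (exp (d\<^sup>2) * erfc d))) UNIV"
    by (simp add: Complex_eq power_mult_distrib exp_of_real [symmetric])
  show "norm (exp (of_real (d\<^sup>2) * (Complex x u)\<^sup>2) / (1 - (Complex x u)\<^sup>2))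
      \<le> exp (d\<^sup>2 * c\<^sup>2) / (1 - c) * inverse (1 + u\<^sup>2)" if "\<bar>x\<bar> \<le> c" for x u
    using that assms by (intro exp_square_over_one_minus_square_bound) auto
  have top: "((\<lambda>u. exp (d\<^sup>2 * c\<^sup>2) / (1 - c) * inverse (1 + u\<^sup>2)) \<longlongrightarrow> 0) at_top"
    by (intro tendsto_mult_right_zero tendsto_inverse_0_at_top
        filterlim_tendsto_add_at_top[OF tendsto_const] filterlim_pow_at_top filterlim_ident) auto
  then show "((\<lambda>u. exp (d\<^sup>2 * c\<^sup>2) / (1 - c) * inverse (1 + u\<^sup>2)) \<longlongrightarrow> 0) at_bot"
    by (simp add: filterlim_at_bot_mirror)
  from top show "((\<lambda>u. exp (d\<^sup>2 * c\<^sup>2) / (1 - c) * inverse (1 + u\<^sup>2)) \<longlongrightarrow> 0) at_top" .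
qed (auto intro!: holomorphic_intros dest: one_minus_square_nonzero)

text \<open>The integrand is the derivative of \<open>exp (a z\<^sup>2) / z ^ (2 k + 1)\<close>, which vanishes at both ends of the line.\<close>

lemma vertical_line_recursion:
  assumes "0 \<le> a" "0 < c"
  shows "((\<lambda>u. 2 * of_real a * (exp (of_real a * (Complex c u)\<^sup>2) / (Complex c u) ^ (2 * k))
    - (2 * of_nat k + 1) * (exp (of_real a * (Complex c u)\<^sup>2) / (Complex c u) ^ (2 * Suc k))) has_integral 0) UNIV"
proof -
  define E where "E z = exp (of_real a * z\<^sup>2) * inverse (z ^ (2 * k + 1))" for z :: complex
  define \<phi> where "\<phi> z = 2 * of_real a * (exp (of_real a * z\<^sup>2) / z ^ (2 * k))
    - (2 * of_nat k + 1) * (exp (of_real a * z\<^sup>2) / z ^ (2 * Suc k))" for z :: complex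
  have nz: "Complex c u \<noteq> 0" for u
    using assms by (simp add: complex_eq_iff)
  have D: "(E has_field_derivative \<phi> z) (at z)" if "z \<noteq> 0" for z
  proof -
    have "(E has_field_derivative exp (of_real a * z\<^sup>2) * (of_real a * (2 * z)) * inverse (z ^ (2 * k + 1))
        + exp (of_real a * z\<^sup>2) * (- (inverse (z ^ (2 * k + 1)) * (of_nat (2 * k + 1) * z ^ (2 * k)) *
            inverse (z ^ (2 * k + 1))))) (at z)"
      unfolding E_def [abs_def] using that
      by (auto intro!: derivative_eq_intros simp del: power_Suc)
    moreover have "exp (of_real a * z\<^sup>2) * (of_real a * (2 * z)) * inverse (z ^ (2 * k + 1))
        + exp (of_real a * z\<^sup>2) * (- (inverse (z ^ (2 * k + 1)) * (of_nat (2 * k + 1) * z ^ (2 * k)) *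
            inverse (z ^ (2 * k + 1)))) = \<phi> z"
      unfolding \<phi>_def using that by (simp add: field_simps power2_eq_square)
    ultimately show ?thesis by simp
  qed
  \<comment> \<open>For a = 0 the exponential gives no decay, so one factor of the power supplies 1
    / |u| and the other 2 k are bounded through \<open>c\<close>.\<close>
  have bound: "norm (E (Complex c u)) \<le> exp (a * c\<^sup>2) * (inverse (c ^ (2 * k)) * inverse \<bar>u\<bar>)" if "u \<noteq> 0" for u
  proof -
    have n: "c \<le> norm (Complex c u)" "\<bar>u\<bar> \<le> norm (Complex c u)"
      using abs_Re_le_cmod[of "Complex c u"] abs_Im_le_cmod[of "Complex c u"] assms by auto
    have "norm (E (Complex c u)) = exp (a * (c\<^sup>2 - u\<^sup>2)) *
        (inverse (norm (Complex c u) ^ (2 * k)) * inverse (norm (Complex c u)))"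
      unfolding E_def norm_mult norm_exp_mult_square norm_inverse norm_power by simp
    also have "\<dots> \<le> exp (a * c\<^sup>2) * (inverse (c ^ (2 * k)) * inverse \<bar>u\<bar>)"
      using n assms that
      by (intro mult_mono le_imp_inverse_le power_mono) (auto intro!: mult_left_mono)
    finally show ?thesis .
  qed
  have lim: "((\<lambda>u. E (Complex c u) - 0) \<longlongrightarrow> 0) F"
    if "filterlim (\<lambda>u::real. \<bar>u\<bar>) at_top F" for F
  proof (rule Lim_null_comparison)
    have "\<forall>\<^sub>F u::real in F. \<bar>u\<bar> \<ge> 1"
      using that by (simp add: filterlim_at_top)
    then show "\<forall>\<^sub>F u in F. norm (E (Complex c u) - 0) \<le> exp (a * c\<^sup>2) * (inverse (c ^ (2 * k)) * inverse \<bar>u\<bar>)"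
      by eventually_elim (use bound in auto)
    show "((\<lambda>u. exp (a * c\<^sup>2) * (inverse (c ^ (2 * k)) * inverse \<bar>u\<bar>)) \<longlongrightarrow> 0) F"
      by (intro tendsto_mult_right_zero tendsto_inverse_0_at_top that)
  qed
  have abs_at_bot: "filterlim (\<lambda>t::real. \<bar>t\<bar>) at_top at_bot"
    using filterlim_abs_real by (simp add: filterlim_at_bot_mirror)
  have "((\<lambda>u. \<i> * \<phi> (Complex c u)) has_integral 0) UNIV"
  \<comment> \<open>Comparison with the zero function: a primitive vanishing at both ends gives
    integral 0.\<close>
  proof (rule has_integral_UNIV_transfer[where v = "\<lambda>u. u" and f = "\<lambda>_. 0" and F = "\<lambda>_. 0"])
    show "((\<lambda>u. \<i> * \<phi> (Complex c u)) has_integral E (Complex c r) - E (Complex c l)) {l..r}" if "l \<le> r" for l r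
      using that by (intro has_integral_vertical_segment D nz)
    show "((\<lambda>u. E (Complex c u) - 0) \<longlongrightarrow> 0) at_bot" "((\<lambda>u. E (Complex c u) - 0) \<longlongrightarrow> 0) at_top"
      by (intro lim abs_at_bot filterlim_abs_real)+
  qed (auto intro: filterlim_ident)
  from has_integral_mult_right[OF this, of "- \<i>"] show ?thesis
    unfolding \<phi>_def by simp
qed

text \<open>\<open>vertical_line_recursion\<close> multiplies the value by 2 d^2 / (2 k + 1) from k
  to k + 1, matching Gamma(k + 3/2) = (k + 1/2) Gamma(k + 1/2). The start k = 0 is the Gaussian
  integral with Gamma(1/2) = sqrt pi.\<close>

lemma hankel_vertical_line_pos:
  assumes "0 < d" "0 < c" "c < 1"
  shows "((\<lambda>u. exp (of_real (d\<^sup>2) * (Complex c u)\<^sup>2) / (Complex c u) ^ (2 * k)) has_integral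
    of_real (pi * (d\<^sup>2) ^ k / (d * Gamma (real k + 1/2)))) UNIV"
proof (induction k)
  case 0
  have "pi / (d * sqrt pi) = sqrt pi / d"
    using assms by (simp add: field_simps)
  with gaussian_vertical_line[of d c] show ?case
    using assms by (simp add: Gamma_one_half_real)
next
  case (Suc k)
  let ?I = "pi * (d\<^sup>2) ^ k / (d * Gamma (real k + 1/2))"
  let ?e = "\<lambda>k u. exp (of_real (d\<^sup>2) * (Complex c u)\<^sup>2) / (Complex c u) ^ (2 * k)"
  have "((\<lambda>u. 2 * of_real (d\<^sup>2) * ?e k u
      - (2 * of_real (d\<^sup>2) * ?e k u - (2 * of_nat k + 1) * ?e (Suc k) u)) has_integral
      2 * of_real (d\<^sup>2) * of_real ?I - 0) UNIV"
    using assms by (intro has_integral_diff has_integral_mult_right Suc vertical_line_recursion) auto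
  then have "((\<lambda>u. (2 * of_nat k + 1) * ?e (Suc k) u) has_integral 2 * of_real (d\<^sup>2) * of_real ?I) UNIV"
    by simp
  then have *: "((\<lambda>u. inverse (2 * of_nat k + 1) * ((2 * of_nat k + 1) * ?e (Suc k) u)) has_integral
      inverse (2 * of_nat k + 1) * (2 * of_real (d\<^sup>2) * of_real ?I)) UNIV"
    by (rule has_integral_mult_right)
  have nz: "(2 * of_nat k + 1 :: complex) \<noteq> 0"
    by (metis of_nat_Suc of_nat_mult of_nat_numeral of_nat_neq_0 add.commute)
  have "inverse (2 * of_nat k + 1) * (2 * of_real (d\<^sup>2) * of_real ?I) =
      complex_of_real (inverse (2 * real k + 1) * (2 * d\<^sup>2 * ?I))"
    by simp
  also have "inverse (2 * real k + 1) * (2 * d\<^sup>2 * ?I) = pi * (d\<^sup>2) ^ Suc k / (d * Gamma (real (Suc k) + 1/2))"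
  proof -
    define g where "g = Gamma (real k + 1/2)"
    have "real k + 1/2 \<notin> \<int>\<^sub>\<le>\<^sub>0"
      using nonpos_Ints_nonpos[of "real k + 1/2"] by auto
    from Gamma_plus1[OF this] have g': "Gamma (real (Suc k) + 1/2) = (2 * real k + 1) / 2 * g"
      by (simp add: g_def add_ac add_divide_distrib)
    have "g > 0"
      unfolding g_def by (intro Gamma_real_pos) auto
    moreover have "2 * real k + 1 > 0"
      by simp
    ultimately show ?thesis
      unfolding g' g_def[symmetric] using assms(1) by (simp add: field_simps)
  qed
  finally show ?case
    using * nz by (simp add: mult.assoc[symmetric])
qed

text \<open>Raising the exponent by one step turns the factor 1 / d into d, so that d = 0 can be
  included. There the exponential is 1 and the recursion directly gives integral 0.\<close>

lemma hankel_vertical_line: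
  assumes "0 \<le> d" "0 < c" "c < 1"
  shows "((\<lambda>u. exp (of_real (d\<^sup>2) * (Complex c u)\<^sup>2) / (Complex c u) ^ (2 * Suc k)) has_integral
    of_real (pi * (d * (d\<^sup>2) ^ k / Gamma (real k + 3/2)))) UNIV"
proof (cases "d = 0")
  case True
  have nz: "(2 * of_nat k + 1 :: complex) \<noteq> 0"
    by (metis of_nat_Suc of_nat_mult of_nat_numeral of_nat_neq_0 add.commute)
  have "((\<lambda>u. - ((2 * of_nat k + 1) * (1 / (Complex c u) ^ (2 * Suc k)))) has_integral 0) UNIV"
    using vertical_line_recursion[of 0 c k] assms by simp
  from has_integral_mult_right[OF this, of "- inverse (2 * of_nat k + 1)"]
  have "((\<lambda>u. - inverse (2 * of_nat k + 1) * - ((2 * of_nat k + 1) * (1 / (Complex c u) ^ (2 * Suc k))))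
      has_integral 0) UNIV"
    by simp
  moreover have "- inverse (2 * of_nat k + 1) * - ((2 * of_nat k + 1) * w) = w" for w :: complex
    using nz by (simp add: mult.assoc[symmetric])
  ultimately have "((\<lambda>u. 1 / (Complex c u) ^ (2 * Suc k)) has_integral 0) UNIV"
    by (simp only:)
  then show ?thesis
    using True by simp
next
  case False
  then have d: "d > 0"
    using assms by simp
  have eq: "pi * (d\<^sup>2) ^ Suc k / (d * Gamma (real (Suc k) + 1/2)) = pi * (d * (d\<^sup>2) ^ k / Gamma (real k + 3/2))"
    using d by (simp add: power2_eq_square add_ac field_simps)
  from hankel_vertical_line_pos[OF d assms(2,3), of "Suc k"] show ?thesis
    unfolding eq .
qed

lemma erfc_hankel_vertical_line:
  assumes "0 \<le> d" "0 < c" "c < 1"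
  shows "((\<lambda>u. exp (of_real (d\<^sup>2) * (Complex c u)\<^sup>2) / (1 - (Complex c u)\<^sup>2) / (Complex c u) ^ (2 * k)) has_integral
    of_real (pi * (exp (d\<^sup>2) * erfc d + (\<Sum>j<k. d * (d\<^sup>2) ^ j / Gamma (real j + 3/2))))) UNIV"
proof (induction k)
  case 0
  show ?case
    using erfc_vertical_line[of d c] assms by simp
next
  case (Suc k)
  have "exp (of_real (d\<^sup>2) * z\<^sup>2) / (1 - z\<^sup>2) / z ^ (2 * k) + exp (of_real (d\<^sup>2) * z\<^sup>2) / z ^ (2 * Suc k) =
      exp (of_real (d\<^sup>2) * z\<^sup>2) / (1 - z\<^sup>2) / z ^ (2 * Suc k)" if "Re z = c" for z :: complex
  proof -
    have nz: "z \<noteq> 0" "1 - z\<^sup>2 \<noteq> 0"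
      using that assms one_minus_square_nonzero[of z] by auto
    \<comment> \<open>Partial fractions 1 / (1 - q) + 1 / q = 1 / ((1 - q) q), used with q = z^2 and
      p = z^(2 k). Each induction step thus adds one Hankel integral.\<close>
    have alg: "e / w / p + e / (p * q) = e / w / (p * q)"
      if "w \<noteq> 0" "p \<noteq> 0" "q \<noteq> 0" "w = 1 - q" for e w p q :: complex
    proof -
      have "e / w / p + e / (p * q) = e * (q + w) / (w * (p * q))"
        using that(1-3) by (simp add: divide_simps) (simp add: algebra_simps)
      then show ?thesis
        using that(4) by simp
    qed
    have pw: "z ^ (2 * Suc k) = z ^ (2 * k) * z\<^sup>2"
      by (simp add: power2_eq_square mult_ac)
    show ?thesis
      unfolding pw by (rule alg) (use nz in auto)
  qed
  then have eq: "exp (of_real (d\<^sup>2) * (Complex c u)\<^sup>2) / (1 - (Complex c u)\<^sup>2) / Complex c u ^ (2 * k)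
      + exp (of_real (d\<^sup>2) * (Complex c u)\<^sup>2) / Complex c u ^ (2 * Suc k) =
      exp (of_real (d\<^sup>2) * (Complex c u)\<^sup>2) / (1 - (Complex c u)\<^sup>2) / Complex c u ^ (2 * Suc k)" for u
    by simp
  have sum: "complex_of_real (pi * (exp (d\<^sup>2) * erfc d + (\<Sum>j<k. d * (d\<^sup>2) ^ j / Gamma (real j + 3/2))))
      + of_real (pi * (d * (d\<^sup>2) ^ k / Gamma (real k + 3/2))) =
      of_real (pi * (exp (d\<^sup>2) * erfc d + (\<Sum>j<Suc k. d * (d\<^sup>2) ^ j / Gamma (real j + 3/2))))"
    by (simp add: ring_distribs)
  show ?case
    using has_integral_add[OF Suc hankel_vertical_line[OF assms, of k]] unfolding eq sum .
qed

section \<open>Termwise integration of the binomial series and summation of the result\<close>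

text \<open>On the line |z| \<ge> c > sqrt y, so |y / z^2| \<le> y / c^2 < 1 uniformly in u. The
  binomial series is dominated by a convergent numerical series times the integrable function |g|,
  which justifies exchanging sum and integral.\<close>

lemma line_kernel_integral:
  assumes a: "0 \<le> a" and b: "0 \<le> b" and y: "0 < y" and c: "sqrt y < c" "c < 1"
    and I: "\<And>k. ((\<lambda>u. exp (of_real a * (Complex c u)\<^sup>2) / (1 - (Complex c u)\<^sup>2) / (Complex c u) ^ (2 * k))
      has_integral I k) UNIV"
  obtains S where "((\<lambda>u. line_kernel a b y (Complex c u)) has_integral S) UNIV"
    and "(\<lambda>k. of_real (pochhammer b k / fact k * y ^ k) * I k) sums S"
proof -
  define \<beta> where "\<beta> k = pochhammer b k / fact k" for k
  have \<beta>: "\<beta> k \<ge> 0" for k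
    using b by (cases "b = 0") (auto simp: \<beta>_def pochhammer_0_left pochhammer_pos less_imp_le)
  define g where "g u = exp (of_real a * (Complex c u)\<^sup>2) / (1 - (Complex c u)\<^sup>2)" for u
  define f where "f k u = of_real (\<beta> k * y ^ k) * (g u / (Complex c u) ^ (2 * k))" for k u
  have c0: "0 < c"
    using c(1) real_sqrt_gt_zero[OF y] by linarith
  have "y < c\<^sup>2"
    using power_strict_mono[OF c(1), of 2] y by simp
  then have q: "y / c\<^sup>2 < 1" "0 \<le> y / c\<^sup>2"
    using c0 y by simp_all
  have z: "c \<le> norm (Complex c u)" "Complex c u \<noteq> 0" "1 - (Complex c u)\<^sup>2 \<noteq> 0" for u
    using abs_Re_le_cmod[of "Complex c u"] c0 c one_minus_square_nonzero[of "Complex c u"]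
    by (auto simp: complex_eq_iff)
  have cont: "continuous_on UNIV (\<lambda>u. Complex c u)"
    unfolding Complex_eq by (intro continuous_intros)
  have gb: "norm (g u) \<le> exp (a * c\<^sup>2) / (1 - c) * inverse (1 + u\<^sup>2)" for u
    unfolding g_def using a c c0 by (intro exp_square_over_one_minus_square_bound) auto
  have contg: "continuous_on UNIV g"
    unfolding g_def [abs_def] using z by (intro continuous_intros cont) auto
  have gi: "integrable lborel g"
    by (rule integrable_if_quadratic_decay[OF contg gb])
  have fb: "norm (f k u) \<le> \<beta> k * (y / c\<^sup>2) ^ k * norm (g u)" for k u
  proof -
    have "norm (f k u) = \<beta> k * y ^ k * (norm (g u) / norm (Complex c u) ^ (2 * k))"
      using \<beta>[of k] y by (simp add: f_def norm_mult norm_divide norm_power)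
    also have "\<dots> \<le> \<beta> k * y ^ k * (norm (g u) / c ^ (2 * k))"
      using \<beta>[of k] y z[of u] c0 by (intro mult_left_mono divide_left_mono power_mono mult_pos_pos) auto
    also have "\<dots> = \<beta> k * (y / c\<^sup>2) ^ k * norm (g u)"
      by (simp add: power_divide power_mult)
    finally show ?thesis .
  qed
  have fi: "integrable lborel (f k)" for k
  proof (rule Bochner_Integration.integrable_bound)
    show "integrable lborel (\<lambda>u. \<beta> k * (y / c\<^sup>2) ^ k * norm (g u))"
      using gi by simp
    have "continuous_on UNIV (f k)"
      unfolding f_def [abs_def] using z by (intro continuous_intros cont contg) auto
    then show "f k \<in> borel_measurable lborel"
      by (simp add: borel_measurable_continuous_onI)
    show "AE u in lborel. norm (f k u) \<le> norm (\<beta> k * (y / c\<^sup>2) ^ k * norm (g u))"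
      unfolding real_norm_def by (intro AE_I2 order_trans[OF fb abs_ge_self])
  qed
  have sb: "summable (\<lambda>k. \<beta> k * (y / c\<^sup>2) ^ k)"
    using negative_binomial_sums[of "y / c\<^sup>2" b] q by (auto simp: \<beta>_def sums_iff)
  have s1: "summable (\<lambda>k. norm (f k u))" for u
    by (rule summable_comparison_test_ev[OF _ summable_mult2[OF sb, of "norm (g u)"]]) (use fb in auto)
  have s2: "summable (\<lambda>k. \<integral>u. norm (f k u) \<partial>lborel)"
  proof (rule summable_comparison_test_ev[OF _ summable_mult2[OF sb, of "\<integral>u. norm (g u) \<partial>lborel"]])
    have "(\<integral>u. norm (f k u) \<partial>lborel) \<le> (\<integral>u. \<beta> k * (y / c\<^sup>2) ^ k * norm (g u) \<partial>lborel)" for k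
      using fi gi fb by (intro integral_mono) auto
    then show "\<forall>\<^sub>F k in sequentially. norm (\<integral>u. norm (f k u) \<partial>lborel) \<le>
        \<beta> k * (y / c\<^sup>2) ^ k * (\<integral>u. norm (g u) \<partial>lborel)"
      by simp
  qed
  have sum: "(\<Sum>k. f k u) = line_kernel a b y (Complex c u)" for u
  proof -
    have "norm (of_real y / (Complex c u)\<^sup>2) = y / norm (Complex c u) ^ 2"
      using y by (simp add: norm_divide norm_power)
    also have "\<dots> \<le> y / c\<^sup>2"
      using z[of u] c0 y by (intro divide_left_mono power_mono mult_pos_pos) auto
    finally have "norm (of_real y / (Complex c u)\<^sup>2) < 1"
      using q by linarith
    from sums_mult[OF negative_binomial_sums_complex[OF this, of b], of "g u"]
    have "(\<lambda>k. g u * (of_real (pochhammer b k / fact k) * (of_real y / (Complex c u)\<^sup>2) ^ k)) sums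
        line_kernel a b y (Complex c u)"
      by (simp add: g_def line_kernel_def)
    moreover have "g u * (of_real (pochhammer b k / fact k) * (of_real y / (Complex c u)\<^sup>2) ^ k) = f k u" for k
      by (simp add: f_def \<beta>_def power_divide mult_ac flip: power_mult)
    ultimately have "(\<lambda>k. f k u) sums line_kernel a b y (Complex c u)"
      by simp
    then show ?thesis
      by (simp add: sums_iff)
  qed
  define S where "S = (\<integral>u. (\<Sum>k. f k u) \<partial>lborel)"
  have "((\<lambda>u. \<Sum>k. f k u) has_integral S) UNIV"
    unfolding S_def by (intro has_integral_integral_lborel integrable_suminf fi s2 AE_I2 s1)
  then have "((\<lambda>u. line_kernel a b y (Complex c u)) has_integral S) UNIV"
    by (simp add: sum)
  moreover have "(\<lambda>k. integral\<^sup>L lborel (f k)) sums S"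
    unfolding S_def by (intro sums_integral fi s2 AE_I2 s1)
  moreover have "integral\<^sup>L lborel (f k) = of_real (pochhammer b k / fact k * y ^ k) * I k" for k
  proof -
    have "(f k has_integral of_real (\<beta> k * y ^ k) * I k) UNIV"
      unfolding f_def [abs_def] g_def by (intro has_integral_mult_right I)
    \<comment> \<open>The prescribed values \<open>I k\<close> are gauge integrals; since
      \<open>f k\<close> is Lebesgue integrable, uniqueness identifies the two.\<close>
    with has_integral_integral_lborel[OF fi] show ?thesis
      unfolding \<beta>_def using has_integral_unique by blast
  qed
  ultimately show ?thesis
    using that by simp
qed

text \<open>Gamma(j + 3/2) \<ge> j! / 2, because Gamma(3/2) = sqrt pi / 2 \<ge> 1/2 and each step
  multiplies by j + 3/2 \<ge> j + 1. Twice the exponential series is then a majorant. This supplies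
  the convergence needed for the summation by parts.\<close>

lemma summable_power_over_Gamma:
  assumes "0 \<le> a"
  shows "summable (\<lambda>j. d * a ^ j / Gamma (real j + 3/2))"
proof -
  have le: "fact j / 2 \<le> Gamma (real j + 3/2)" for j :: nat
  proof (induction j)
    case 0
    have "Gamma (3/2 :: real) = 1/2 * Gamma (1/2)"
      using Gamma_plus1[of "1/2 :: real"] nonpos_Ints_nonpos[of "1/2 :: real"] by auto
    moreover have "1 \<le> sqrt pi"
      using pi_gt3 by simp
    ultimately show ?case
      by (simp add: Gamma_one_half_real)
  next
    case (Suc j)
    have "Gamma (real (Suc j) + 3/2) = (real j + 3/2) * Gamma (real j + 3/2)"
      using Gamma_plus1[of "real j + 3/2"] nonpos_Ints_nonpos[of "real j + 3/2"] by (auto simp: add_ac)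
    moreover have "real (Suc j) * (fact j / 2) \<le> (real j + 3/2) * Gamma (real j + 3/2)"
      by (intro mult_mono Suc) auto
    ultimately show ?case
      by simp
  qed
  have "norm (a ^ j / Gamma (real j + 3/2)) \<le> 2 * (inverse (fact j) * a ^ j)" for j
  proof -
    have pos: "0 < Gamma (real j + 3/2)"
      by (intro Gamma_real_pos) simp
    then have "norm (a ^ j / Gamma (real j + 3/2)) = a ^ j / Gamma (real j + 3/2)"
      using assms by simp
    also have "\<dots> \<le> a ^ j / (fact j / 2)"
      using assms pos le by (intro divide_left_mono mult_pos_pos) auto
    also have "\<dots> = 2 * (inverse (fact j) * a ^ j)"
      by (simp add: field_simps)
    finally show ?thesis .
  qed
  then have "summable (\<lambda>j. a ^ j / Gamma (real j + 3/2))"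
    by (intro summable_comparison_test_ev[OF _ summable_mult[OF summable_exp[of a], of 2]]) auto
  from summable_mult[OF this, of d] show ?thesis
    by simp
qed

theorem theorem3p6:
  fixes n x \<delta> :: real and \<gamma> :: "real \<Rightarrow> complex"
  assumes "n > 0" and "x > 0" and "\<delta> \<ge> 0"
    and "loop_contour (nct_y n x) \<gamma>"
  shows "nct_H n x \<delta> \<gamma> = of_real (nct_P n x \<delta> + nct_R n x \<delta>) \<and>
    of_real (nct_F n x \<delta>) = 2 * nct_H n x \<delta> \<gamma> - of_real (nct_R n x \<delta>)"
proof -
  define y where "y = nct_y n x"
  define b where "b = n / 2"
  define d where "d = \<delta> / sqrt 2"
  have y: "0 < y" "y < 1"
    using assms by (auto simp: y_def nct_y_def divide_simps add_pos_pos)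
  have b: "0 < b"
    using assms by (simp add: b_def)
  \<comment> \<open>\<open>nct_H\<close> depends on \<delta> only through its square, whereas
    \<open>erfc\<close> and \<open>nct_Q\<close> see its sign. Nonnegativity makes \<open>d\<close>
    the root of \<open>d\<^sup>2\<close> that the Gaussian integrals produce.\<close>
  have d: "0 \<le> d" "\<delta>\<^sup>2 / 2 = d\<^sup>2"
    using assms by (simp_all add: d_def power_divide)
  have "sqrt y < 1"
    using y by simp
  then obtain c where c: "sqrt y < c" "c < 1"
    using dense by blast
  have c0: "0 < c"
    using c(1) real_sqrt_gt_zero[OF y(1)] by linarith
  define h where "h j = d * (d\<^sup>2) ^ j / Gamma (real j + 3/2)" for j
  \<comment> \<open>The factor (1 - y)^b from the prefactor of \<open>nct_H\<close> normalizes the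
    weights to total mass 1.\<close>
  define w where "w k = pochhammer b k / fact k * y ^ k * (1 - y) powr b" for k
  define K where "K = exp (d\<^sup>2) * erfc d"
  obtain S where S: "((\<lambda>u. line_kernel (d\<^sup>2) b y (Complex c u)) has_integral S) UNIV"
    "(\<lambda>k. of_real (pochhammer b k / fact k * y ^ k) * complex_of_real (pi * (K + (\<Sum>j<k. h j)))) sums S"
    unfolding h_def K_def
    by (rule line_kernel_integral[OF zero_le_power2 less_imp_le[OF b] y(1) c
          erfc_hankel_vertical_line[OF d(1) c0 c(2)]])
  have sumw: "w sums 1"
    using sums_mult2[OF negative_binomial_sums[of y b], of "(1 - y) powr b"] y
    by (simp add: w_def [abs_def] powr_minus)
  define s where "s = Re S"
  have S': "(\<lambda>k. of_real (pochhammer b k / fact k * y ^ k * (pi * (K + (\<Sum>j<k. h j))))) sums S"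
    using S(2) unfolding of_real_mult[symmetric] .
  have s: "(\<lambda>k. pochhammer b k / fact k * y ^ k * (pi * (K + (\<Sum>j<k. h j)))) sums s"
    using sums_Re[OF S'] unfolding Re_complex_of_real s_def .
  \<comment> \<open>All terms of the series are real, so the line integral is real and can be
    compared with the real functions \<open>nct_Q\<close> and \<open>erfc\<close>.\<close>
  have S_eq: "S = of_real s"
    by (rule sums_unique2[OF S' sums_of_real[OF s]])
  from sums_mult[OF s, of "(1 - y) powr b / pi"]
  have "(\<lambda>k. w k * (K + (\<Sum>j<k. h j))) sums ((1 - y) powr b / pi * s)"
    by (simp add: w_def mult_ac)
  then have "(\<lambda>j. h j * (1 - (\<Sum>k\<le>j. w k))) sums ((1 - y) powr b / pi * s - K)"
    using sums_weighted_partial_sums_iff[OF sumw] summable_power_over_Gamma[of "d\<^sup>2" d]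
    by (simp add: h_def [abs_def])
  then have "(\<lambda>j. h j * inc_beta y (real j + 1) b) sums ((1 - y) powr b / pi * s - K)"
    using inc_beta_eq_one_minus_negative_binomial[OF y b] by (simp add: w_def)
  then have Q: "nct_Q n x \<delta> = 1/2 * exp (- d\<^sup>2) * ((1 - y) powr b / pi * s - K)"
    by (simp add: nct_Q_def d d_def[symmetric] y_def[symmetric] b_def[symmetric] h_def sums_iff mult_ac)
  \<comment> \<open>\<open>nct_P\<close> cancels, leaving
    \<open>erfc d / 2 + nct_Q n x \<delta>\<close>. Since exp (-d^2) K = erfc d, the term -K in
    \<open>Q\<close> removes the error function.\<close>
  have P_R: "nct_P n x \<delta> + nct_R n x \<delta> = 1/2 * exp (- d\<^sup>2) * ((1 - y) powr b / pi * s)"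
    unfolding nct_R_def Q d_def[symmetric] K_def by (simp add: algebra_simps flip: exp_add)
  have "((\<lambda>t. of_real (sqrt y) / 2 * (nct_H_integrand n x \<delta> (\<gamma> t) * vector_derivative \<gamma> (at t)))
      has_integral \<i> * S) UNIV"
    using loop_contour_integral_eq_line_integral[OF _ _ y _ c S(1)] assms(4) b
    by (simp add: nct_H_integrand_def d(2) y_def[symmetric] b_def)
  \<comment> \<open>This undoes the factor sqrt y / 2 of the substitution; the remaining \<i>
    cancels against 2 pi \<i> in \<open>nct_H\<close>.\<close>
  from has_integral_mult_right[OF this, of "2 / of_real (sqrt y)"]
  have "loop_integral \<gamma> (nct_H_integrand n x \<delta>) = 2 / of_real (sqrt y) * (\<i> * of_real s)"
    using y S_eq by (simp add: loop_integral_def integral_unique)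
  then have H: "nct_H n x \<delta> \<gamma> = of_real (nct_P n x \<delta> + nct_R n x \<delta>)"
    unfolding nct_H_def P_R using y d(2) by (simp add: y_def[symmetric] b_def)
  moreover have "nct_F n x \<delta> = 2 * (nct_P n x \<delta> + nct_R n x \<delta>) - nct_R n x \<delta>"
    by (simp add: nct_F_def nct_R_def)
  ultimately show ?thesis
    by simp
qed

end
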